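(* There exist universal constants $0<c\le C<\infty$ such that the following holds. Let $n\ge 1$ be an integer, and for each $i\in\{1,\dots,n\}$ let $P_i,Q_i$ be arbitrary probability measures on a measurable space $(\mathsf X_i,\mathcal F_i)$. Let $\mathbf P=\bigotimes_{i=1}^n P_i$ and $\mathbf Q=\bigotimes_{i=1}^n Q_i$. Let $M_i=\frac{P_i+Q_i}{2}$, let $u_i=\frac{\mathrm d(P_i-Q_i)}{\mathrm d(P_i+Q_i)}$, let $X_1,\dots,X_n$ be independent random variables with $X_i\sim M_i$, and set $U_i=u_i(X_i)$. For $t>0$ put $$ G(t):=\sum_{i=1}^n\log\mathbb E\sqrt{1+\frac{U_i^2}{t^2}}. $$ If $\mathbf P\neq\mathbf Q$, then the equation $G(T)=\frac12$ has a unique solution $T>0$; let $T$ denote this solution. If $\mathbf P=\mathbf Q$, set $T=0$. Then $$ c\,\min\{1,T\}\le \mathrm{TV}(\mathbf P,\mathbf Q)\le C\,\min\{1,T\}. $$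
   Context: For probability measures $P,Q$ on a measurable space $(\mathsf X,\mathcal F)$, the total variation distance is $\mathrm{TV}(P,Q):=\sup_{B\in\mathcal F}|P(B)-Q(B)|$. The function $u_i=\frac{\mathrm d(P_i-Q_i)}{\mathrm d(P_i+Q_i)}$ is the Radon–Nikodym derivative of the signed measure $P_i-Q_i$ with respect to the measure $P_i+Q_i$ (if $P_i,Q_i$ have densities or mass functions $p_i,q_i$, then $u_i=(p_i-q_i)/(p_i+q_i)$ with $0/0:=0$). "Universal constants" means that $c,C$ do not depend on $n$, on the spaces, or on the measures. *)

theory Defs
  imports "HOL-Probability.Probability"
begin

text \<open>The supremum ranges over a nonempty set of reals bounded by 1 when \<open>P\<close> and \<open>Q\<close> are
  probability measures.\<close>

definition total_variation :: "'a measure \<Rightarrow> 'a measure \<Rightarrow> real" where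
  "total_variation P Q = (SUP B\<in>sets P. \<bar>measure P B - measure Q B\<bar>)"

text \<open>\<open>P + Q\<close> for measures on the same measurable space.\<close>

definition measure_plus :: "'a measure \<Rightarrow> 'a measure \<Rightarrow> 'a measure" where
  "measure_plus P Q = measure_of (space P) (sets P) (\<lambda>A. emeasure P A + emeasure Q A)"

lemma space_measure_plus [simp]: "space (measure_plus P Q) = space P"
  by (simp add: measure_plus_def)

lemma sets_measure_plus [simp, measurable_cong]: "sets (measure_plus P Q) = sets P"
  by (simp add: measure_plus_def)

lemma emeasure_measure_plus:
  assumes "sets Q = sets P" "A \<in> sets P"
  shows "emeasure (measure_plus P Q) A = emeasure P A + emeasure Q A"
  unfolding measure_plus_def
proof (rule emeasure_measure_of_sigma)
  show "sigma_algebra (space P) (sets P)" ..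
  show "positive (sets P) (\<lambda>A. emeasure P A + emeasure Q A)"
    by (simp add: positive_def)
  show "countably_additive (sets P) (\<lambda>A. emeasure P A + emeasure Q A)"
    using assms(1)
    by (auto simp: countably_additive_def suminf_add[symmetric] suminf_emeasure)
  show "A \<in> sets P" by fact
qed

definition midpoint_measure :: "'a measure \<Rightarrow> 'a measure \<Rightarrow> 'a measure" where
  "midpoint_measure P Q = scale_measure (1/2) (measure_plus P Q)"

text \<open>\<open>u\<close> is a version of the Radon-Nikodym derivative \<open>d(P - Q)/d(P + Q)\<close> of the signed measure
  \<open>P - Q\<close>. The derivative is determined only up to null sets, hence a predicate.\<close>

definition is_RN_deriv_diff_sum :: "'a measure \<Rightarrow> 'a measure \<Rightarrow> ('a \<Rightarrow> real) \<Rightarrow> bool" where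
  "is_RN_deriv_diff_sum P Q u \<longleftrightarrow>
     integrable (measure_plus P Q) u \<and>
     (\<forall>A\<in>sets P. measure P A - measure Q A = (LINT x:A|measure_plus P Q. u x))"

definition log_sqrt_sum :: "'b measure \<Rightarrow> nat \<Rightarrow> (nat \<Rightarrow> 'b \<Rightarrow> real) \<Rightarrow> real \<Rightarrow> real" where
  "log_sqrt_sum \<Omega> n U t = (\<Sum>i=1..n. ln (LINT \<omega>|\<Omega>. sqrt (1 + (U i \<omega>)\<^sup>2 / t\<^sup>2)))"

text \<open>In HOL an existential statement about reals cannot be placed outside the quantification over
  types, so a bare \<open>\<exists>c C\<close> followed by measures over a type \<open>'a\<close> would allow the constants to depend
  on \<open>'a\<close>, i.e. on the underlying spaces. Confining the constants to one monomorphic compact subset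
  of the positive reals makes them uniform in the types: the validity of a pair \<open>(c, C)\<close> is
  monotone, so if for every type some pair in this range works, then its two endpoints work for
  all types at once. The particular endpoints carry no meaning.\<close>

definition universal_range :: "real set" where
  "universal_range = {1 / 10^12 .. 10^12}"

end

theory Submission
  imports Defs
begin

text \<open>
  Relative to the law of \<open>(X\<^sub>1, \<dots>, X\<^sub>n)\<close> the two product measures have densities
  \<open>f = \<Prod>(1 + U\<^sub>i)\<close> and \<open>g = \<Prod>(1 - U\<^sub>i)\<close>, so the total variation distance is \<open>E\<bar>f - g\<bar> / 2\<close>. This turns
  the theorem into a statement about independent centred variables \<open>U\<^sub>i\<close> with values in \<open>[-1, 1]\<close>.

  Write \<open>w\<^sub>i = \<surd>(1 + U\<^sub>i\<^sup>2 / T\<^sup>2)\<close>, \<open>w = \<Prod>w\<^sub>i\<close> and \<open>b\<^sub>i = E w\<^sub>i - 1\<close>. The equation for \<open>T\<close> says that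
  \<open>\<Prod>(1 + b\<^sub>i) = exp (1/2)\<close>, which forces \<open>1/2 \<le> \<Sum>b\<^sub>i \<le> 2\<close>; every estimate below is expressed through
  the \<open>b\<^sub>i\<close>. The variable \<open>U\<^sub>i\<^sup>2 / w\<^sub>i\<close> lies between \<open>T\<^sup>2 (w\<^sub>i - 1)\<close> and twice that, so its mean \<open>\<gamma>\<^sub>i\<close> lies between
  \<open>T\<^sup>2 b\<^sub>i\<close> and \<open>2 T\<^sup>2 b\<^sub>i\<close>; and since \<open>E U\<^sub>i = 0\<close>, the mean \<open>\<beta>\<^sub>i = E (U\<^sub>i / w\<^sub>i)\<close> is at most \<open>T b\<^sub>i\<close> in absolute value.

  \<^emph>\<open>Upper bound\<close> (\<open>tilt_distance_upper\<close>). The weight \<open>w\<close> has bounded mean, so by the inequality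
  \<open>\<bar>z\<bar> \<le> z\<^sup>2 / (2 k w) + k w / 2\<close> it suffices that \<open>E ((f - g)\<^sup>2 / w)\<close> is \<open>O(T\<^sup>2)\<close>. With
  \<open>\<alpha>\<^sub>i = E (1 / w\<^sub>i)\<close>, independence turns that expectation into the second difference
  \<open>\<Prod>(\<alpha>\<^sub>i + 2\<beta>\<^sub>i + \<gamma>\<^sub>i) + \<Prod>(\<alpha>\<^sub>i - 2\<beta>\<^sub>i + \<gamma>\<^sub>i) - 2 \<Prod>(\<alpha>\<^sub>i - \<gamma>\<^sub>i)\<close>, in which the first-order terms in \<open>\<beta>\<close>
  cancel (\<open>prod_second_difference_le\<close>).

  \<^emph>\<open>Lower bound for\<close> \<open>T \<le> 1\<close> (\<open>tilt_distance_lower_small\<close>). Test \<open>f - g\<close> against the function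
  \<open>exp (\<i> \<Sum>\<theta>\<^sub>i)\<close> of modulus one, where \<open>\<theta>\<^sub>i = l U\<^sub>i / (T w\<^sub>i)\<close> with a small constant \<open>l\<close>. Again
  by independence the result is a difference of two products, whose factors
  \<open>E ((1 \<plusminus> U\<^sub>i) exp (\<i> \<theta>\<^sub>i))\<close> lie within \<open>O(l b\<^sub>i)\<close> of \<open>1\<close> and differ by
  \<open>2\<i> E (U\<^sub>i \<theta>\<^sub>i) = 2\<i> l \<gamma>\<^sub>i / T\<close> up to a relative error \<open>O(l)\<close>. All leading terms point in
  the same direction, and their sum has modulus at least \<open>l T\<close>.

  \<^emph>\<open>Lower bound for\<close> \<open>T \<ge> 1\<close> (\<open>tilt_distance_lower_large\<close>). Here \<open>\<Sum>E U\<^sub>i\<^sup>2 \<ge> 1\<close>, so the Hellinger affinity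
  \<open>E \<surd>(f g) = \<Prod>E \<surd>(1 - U\<^sub>i\<^sup>2)\<close> is bounded away from \<open>1\<close>.

  Existence and uniqueness of \<open>T\<close> (\<open>ex1_log_weight_sum_eq_half\<close>) follow after the substitution
  \<open>s = 1 / t\<close>: as a function of \<open>s \<ge> 0\<close> the sum of logarithms is continuous, strictly increasing and
  unbounded, and it vanishes at \<open>0\<close>.
\<close>

section \<open>The weight\<close>

definition sqrt_weight :: "real \<Rightarrow> real \<Rightarrow> real" where
  "sqrt_weight t y = sqrt (1 + y\<^sup>2 / t\<^sup>2)"

lemma sqrt_weight_measurable [measurable]: "sqrt_weight t \<in> borel_measurable borel"
  unfolding sqrt_weight_def[abs_def] by measurable

lemma sqrt_weight_ge_1: "1 \<le> sqrt_weight t y"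
  unfolding sqrt_weight_def by simp

lemma sqrt_weight_pos: "0 < sqrt_weight t y"
  using sqrt_weight_ge_1[of t y] by linarith

lemma sqrt_weight_le:
  assumes "\<bar>y\<bar> \<le> 1"
  shows "sqrt_weight t y \<le> sqrt (1 + 1 / t\<^sup>2)"
proof -
  have "y\<^sup>2 \<le> 1" using assms abs_square_le_1 by blast
  then show ?thesis unfolding sqrt_weight_def by (simp add: divide_right_mono)
qed

lemma sqrt_weight_square: "t > 0 \<Longrightarrow> y\<^sup>2 = t\<^sup>2 * ((sqrt_weight t y)\<^sup>2 - 1)"
  unfolding sqrt_weight_def by (simp add: add_nonneg_nonneg)

lemma abs_le_sqrt_weight: "t > 0 \<Longrightarrow> \<bar>y\<bar> \<le> t * sqrt_weight t y"
proof -
  assume t: "t > 0"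
  have "y\<^sup>2 \<le> (t * sqrt_weight t y)\<^sup>2"
    using sqrt_weight_square[OF t, of y] t by (simp add: power_mult_distrib right_diff_distrib)
  then show ?thesis
    using t sqrt_weight_pos[of t y] by (metis abs_le_square_iff abs_of_pos mult_pos_pos)
qed

text \<open>
  With \<open>w = \<surd>(1 + y\<^sup>2 / t\<^sup>2)\<close> the identity \<open>y\<^sup>2 = t\<^sup>2 (w - 1) (w + 1)\<close> makes \<open>t (w - 1)\<close> behave like
  \<open>y\<^sup>2 / t\<close> for small \<open>y\<close> and like \<open>\<bar>y\<bar>\<close> for large \<open>y\<close>. The function \<open>y / w\<close> is a smooth truncation of
  \<open>y\<close> at level \<open>t\<close>, and \<open>w - 1\<close> controls both the error of the truncation and its second moment.
\<close>
lemma abs_diff_sqrt_weight: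
  assumes "t > 0"
  shows "\<bar>y - y / sqrt_weight t y\<bar> \<le> t * (sqrt_weight t y - 1)"
proof -
  define w where "w = sqrt_weight t y"
  have w: "w \<ge> 1" "\<bar>y\<bar> \<le> t * w"
    using sqrt_weight_ge_1 abs_le_sqrt_weight[OF assms] by (auto simp: w_def)
  have "y - y / w = y / w * (w - 1)"
    using w by (simp add: field_simps)
  then have "\<bar>y - y / w\<bar> = \<bar>y\<bar> / w * (w - 1)"
    using w by (simp add: abs_mult)
  also have "\<dots> \<le> t * (w - 1)"
    using w by (intro mult_right_mono) (auto simp: field_simps)
  finally show ?thesis unfolding w_def .
qed

lemma square_div_sqrt_weight_le:
  assumes "t > 0"
  shows "y\<^sup>2 / sqrt_weight t y \<le> 2 * t\<^sup>2 * (sqrt_weight t y - 1)"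
proof -
  define w where "w = sqrt_weight t y"
  have w: "w \<ge> 1" unfolding w_def by (rule sqrt_weight_ge_1)
  have y: "y\<^sup>2 = t\<^sup>2 * (w\<^sup>2 - 1)" unfolding w_def by (rule sqrt_weight_square[OF assms])
  have "t\<^sup>2 * (w - 1) * (w + 1) \<le> t\<^sup>2 * (w - 1) * (2 * w)"
    using w by (intro mult_left_mono) auto
  moreover have "y\<^sup>2 = t\<^sup>2 * (w - 1) * (w + 1)" unfolding y by algebra
  ultimately have "y\<^sup>2 \<le> 2 * t\<^sup>2 * (w - 1) * w" by (simp only: mult_ac)
  then show ?thesis
    unfolding w_def[symmetric] using w by (subst pos_divide_le_eq) auto
qed

lemma square_div_sqrt_weight_ge:
  assumes "t > 0"
  shows "t\<^sup>2 * (sqrt_weight t y - 1) \<le> y\<^sup>2 / sqrt_weight t y"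
proof -
  define w where "w = sqrt_weight t y"
  have w: "w \<ge> 1" unfolding w_def by (rule sqrt_weight_ge_1)
  have y: "y\<^sup>2 = t\<^sup>2 * (w\<^sup>2 - 1)" unfolding w_def by (rule sqrt_weight_square[OF assms])
  have "t\<^sup>2 * (w - 1) * w \<le> t\<^sup>2 * (w - 1) * (w + 1)"
    using w by (intro mult_left_mono) auto
  moreover have "y\<^sup>2 = t\<^sup>2 * (w - 1) * (w + 1)" unfolding y by algebra
  ultimately have "t\<^sup>2 * (w - 1) * w \<le> y\<^sup>2" by simp
  then show ?thesis
    unfolding w_def[symmetric] using w by (subst pos_le_divide_eq) auto
qed

lemma sqrt_weight_minus_1_le: "sqrt_weight t y - 1 \<le> y\<^sup>2 / t\<^sup>2 / 2"
proof -
  have "sqrt_weight t y \<le> 1 + y\<^sup>2 / t\<^sup>2 / 2"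
    unfolding sqrt_weight_def
  proof (rule real_le_lsqrt)
    show "1 + y\<^sup>2 / t\<^sup>2 \<le> (1 + y\<^sup>2 / t\<^sup>2 / 2)\<^sup>2"
      by (simp add: power2_sum)
  qed simp
  then show ?thesis by simp
qed

text \<open>The tangent line of \<open>1 / w\<close> at \<open>w = 2\<close>; it turns \<open>E w \<le> 2\<close> into \<open>E (1 / w) \<ge> 1 / 2\<close>.\<close>
lemma inverse_sqrt_weight_ge: "1 - sqrt_weight t y / 4 \<le> 1 / sqrt_weight t y"
proof -
  define w where "w = sqrt_weight t y"
  have w: "w > 0" using sqrt_weight_pos by (simp add: w_def)
  have "0 \<le> (w - 2)\<^sup>2" by simp
  then show ?thesis unfolding w_def[symmetric] using w
    by (simp add: field_simps power2_eq_square)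
qed

section \<open>Differences of products\<close>

text \<open>
  Replacing the factors \<open>a i\<close> by \<open>b i\<close> one at a time writes the difference of the products as a sum of
  the \<open>a i - b i\<close>, each multiplied by factors that stay close to \<open>1\<close>.
\<close>
lemma norm_prod_diff_minus_sum_le:
  fixes a b :: "'i \<Rightarrow> 'c::{real_normed_field}"
  assumes "finite I"
    and "\<And>i. i \<in> I \<Longrightarrow> norm (a i) \<le> 1" "\<And>i. i \<in> I \<Longrightarrow> norm (b i) \<le> 1"
    and "\<And>i. i \<in> I \<Longrightarrow> norm (a i - 1) \<le> e i" "\<And>i. i \<in> I \<Longrightarrow> norm (b i - 1) \<le> e i"
  shows "norm ((\<Prod>i\<in>I. a i) - (\<Prod>i\<in>I. b i) - (\<Sum>i\<in>I. a i - b i))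
    \<le> (\<Sum>i\<in>I. e i) * (\<Sum>i\<in>I. norm (a i - b i))"
  using assms
proof (induction I)
  case (insert j I)
  define PA PB S N E where "PA = (\<Prod>i\<in>I. a i)" "PB = (\<Prod>i\<in>I. b i)" "S = (\<Sum>i\<in>I. a i - b i)"
    "N = (\<Sum>i\<in>I. norm (a i - b i))" "E = (\<Sum>i\<in>I. e i)"
  note defs = this
  have IH: "norm (PA - PB - S) \<le> E * N"
    unfolding defs using insert.prems by (intro insert.IH) auto
  have e0: "0 \<le> e i" if "i \<in> insert j I" for i
    using insert.prems(3)[OF that] norm_ge_zero order_trans by blast
  have E0: "0 \<le> E" and N0: "0 \<le> N"
    unfolding defs using e0 by (auto intro!: sum_nonneg)
  have PA: "norm (PA - 1) \<le> E"
  proof -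
    have "norm (PA - (\<Prod>i\<in>I. 1)) \<le> (\<Sum>i\<in>I. norm (a i - 1))"
      unfolding defs using insert.prems by (intro norm_prod_diff) auto
    also have "\<dots> \<le> E" unfolding defs using insert.prems by (intro sum_mono) auto
    finally show ?thesis by simp
  qed
  have PAB: "norm (PA - PB) \<le> N"
    unfolding defs using insert.prems by (intro norm_prod_diff) auto
  have "a j * PA - b j * PB - ((a j - b j) + S)
      = (a j - b j) * (PA - 1) + (b j - 1) * (PA - PB) + (PA - PB - S)"
    by (simp add: algebra_simps)
  then have "norm (a j * PA - b j * PB - ((a j - b j) + S))
      \<le> norm ((a j - b j) * (PA - 1)) + norm ((b j - 1) * (PA - PB)) + norm (PA - PB - S)"
    by (metis norm_triangle_le add_mono_thms_linordered_semiring(3) norm_triangle_ineq)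
  also have "\<dots> \<le> norm (a j - b j) * E + e j * N + E * N"
    unfolding norm_mult using insert.prems(4)[of j] PA PAB IH e0[of j]
    by (intro add_mono mult_mono) auto
  also have "\<dots> \<le> (e j + E) * (norm (a j - b j) + N)"
    using e0[of j] by (simp add: algebra_simps)
  finally show ?case
    using insert.hyps unfolding defs by simp
qed simp

lemma exp_le_quadratic:
  fixes x :: real
  assumes "\<bar>x\<bar> \<le> 1"
  shows "exp x \<le> 1 + x + x\<^sup>2"
proof (cases "x \<ge> 0")
  case True
  with assms show ?thesis by (intro exp_bound) auto
next
  case False
  define y where "y = - x"
  have y: "0 < y" "y \<le> 1" using False assms by (auto simp: y_def)
  have "1 + y \<le> exp y" by simp
  then have "exp (- y) \<le> 1 / (1 + y)"
    using y by (simp add: exp_minus field_simps)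
  also have "\<dots> \<le> 1 - y + y\<^sup>2"
  proof -
    have "(1 - y + y\<^sup>2) * (1 + y) = 1 + y ^ 3"
      by (simp add: algebra_simps power2_eq_square power3_eq_cube)
    also have "\<dots> \<ge> 1" using y by simp
    finally show ?thesis using y by (simp add: divide_le_eq)
  qed
  finally show ?thesis by (simp add: y_def)
qed

lemma prod_one_plus_le_exp_sum:
  fixes f :: "'i \<Rightarrow> real"
  assumes "\<And>i. i \<in> I \<Longrightarrow> 0 \<le> 1 + f i"
  shows "(\<Prod>i\<in>I. 1 + f i) \<le> exp (\<Sum>i\<in>I. f i)"
proof (cases "finite I")
  case True
  have "(\<Prod>i\<in>I. 1 + f i) \<le> (\<Prod>i\<in>I. exp (f i))"
    using assms by (intro prod_mono) auto
  then show ?thesis using True by (simp add: exp_sum)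
qed simp

text \<open>
  Dividing by \<open>\<Prod>a i \<le> 1\<close> reduces to factors near \<open>1\<close>. There the first two products are at most
  \<open>exp (\<plusminus>2\<mu> + \<sigma>)\<close> and the third is at least \<open>1 - \<sigma>\<close>, where \<open>\<mu>\<close> and \<open>\<sigma>\<close> are the sums of \<open>b i / a i\<close> and
  \<open>c i / a i\<close>. The constants and the terms linear in \<open>\<mu>\<close> cancel.
\<close>
lemma prod_second_difference_le:
  fixes a b c :: "'i \<Rightarrow> real"
  assumes a: "\<And>i. i \<in> I \<Longrightarrow> 1/2 \<le> a i" "\<And>i. i \<in> I \<Longrightarrow> a i \<le> 1"
    and c: "\<And>i. i \<in> I \<Longrightarrow> 0 \<le> c i" "\<And>i. i \<in> I \<Longrightarrow> c i \<le> a i"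
    and pos: "\<And>i. i \<in> I \<Longrightarrow> 2 * \<bar>b i\<bar> \<le> a i + c i"
    and M: "2 * (\<Sum>i\<in>I. \<bar>b i\<bar>) \<le> m" and S: "2 * (\<Sum>i\<in>I. c i) \<le> s"
    and small: "2 * m + s \<le> 1"
  shows "(\<Prod>i\<in>I. a i + 2 * b i + c i) + (\<Prod>i\<in>I. a i - 2 * b i + c i) - 2 * (\<Prod>i\<in>I. a i - c i)
    \<le> 6 * s + 8 * m\<^sup>2"
proof -
  define \<mu> \<sigma> where "\<mu> = (\<Sum>i\<in>I. b i / a i)" and "\<sigma> = (\<Sum>i\<in>I. c i / a i)"
  define p where "p = (\<Prod>i\<in>I. a i)"
  have apos: "a i > 0" if "i \<in> I" for i using a(1)[OF that] by simp
  have p: "0 \<le> p" "p \<le> 1"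
    unfolding p_def using a(2) less_imp_le[OF apos]
    by (simp_all add: prod_nonneg prod_le_1)
  have \<mu>: "\<bar>\<mu>\<bar> \<le> m"
  proof -
    have "\<bar>\<mu>\<bar> \<le> (\<Sum>i\<in>I. \<bar>b i / a i\<bar>)" unfolding \<mu>_def by (rule sum_abs)
    also have "\<dots> \<le> (\<Sum>i\<in>I. 2 * \<bar>b i\<bar>)"
    proof (rule sum_mono)
      fix i assume i: "i \<in> I"
      have "\<bar>b i\<bar> * 1 \<le> \<bar>b i\<bar> * (2 * a i)" using a(1)[OF i] by (intro mult_left_mono) auto
      then show "\<bar>b i / a i\<bar> \<le> 2 * \<bar>b i\<bar>" using apos[OF i] by (simp add: abs_divide divide_le_eq)
    qed
    finally show ?thesis using M by (simp add: sum_distrib_left)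
  qed
  have \<sigma>: "0 \<le> \<sigma>" "\<sigma> \<le> s"
  proof -
    show "0 \<le> \<sigma>" unfolding \<sigma>_def using c(1) apos by (auto intro!: sum_nonneg divide_nonneg_pos)
    have "\<sigma> \<le> (\<Sum>i\<in>I. 2 * c i)" unfolding \<sigma>_def
    proof (rule sum_mono)
      fix i assume i: "i \<in> I"
      have "c i * 1 \<le> c i * (2 * a i)" using a(1)[OF i] c(1)[OF i] by (intro mult_left_mono) auto
      then show "c i / a i \<le> 2 * c i" using apos[OF i] by (simp add: divide_le_eq)
    qed
    then show "\<sigma> \<le> s" using S by (simp add: sum_distrib_left)
  qed
  have up: "(\<Prod>i\<in>I. a i + 2 * (\<epsilon> * b i) + c i) \<le> p * (1 + (2 * \<epsilon> * \<mu> + \<sigma>) + (2 * \<epsilon> * \<mu> + \<sigma>)\<^sup>2)"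
    if \<epsilon>: "\<epsilon> = 1 \<or> \<epsilon> = -1" for \<epsilon>
  proof -
    have "(\<Prod>i\<in>I. a i + 2 * (\<epsilon> * b i) + c i) = (\<Prod>i\<in>I. a i * (1 + (2 * \<epsilon> * b i + c i) / a i))"
      using apos by (intro prod.cong refl) (simp add: field_simps less_imp_neq[symmetric])
    also have "\<dots> = p * (\<Prod>i\<in>I. 1 + (2 * \<epsilon> * b i + c i) / a i)"
      by (simp add: prod.distrib p_def)
    also have "\<dots> \<le> p * exp (\<Sum>i\<in>I. (2 * \<epsilon> * b i + c i) / a i)"
    proof (intro mult_left_mono prod_one_plus_le_exp_sum p(1))
      fix i assume i: "i \<in> I"
      have "0 \<le> a i + (2 * \<epsilon> * b i + c i)" using pos[OF i] \<epsilon> by auto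
      then have "0 \<le> (a i + (2 * \<epsilon> * b i + c i)) / a i" using apos[OF i] by simp
      then show "0 \<le> 1 + (2 * \<epsilon> * b i + c i) / a i"
        using apos[OF i] by (simp add: add_divide_distrib)
    qed
    also have "(\<Sum>i\<in>I. (2 * \<epsilon> * b i + c i) / a i) = 2 * \<epsilon> * \<mu> + \<sigma>"
      by (simp add: \<mu>_def \<sigma>_def add_divide_distrib sum.distrib sum_distrib_left)
    also have "p * exp (2 * \<epsilon> * \<mu> + \<sigma>) \<le> p * (1 + (2 * \<epsilon> * \<mu> + \<sigma>) + (2 * \<epsilon> * \<mu> + \<sigma>)\<^sup>2)"
      using \<epsilon> \<mu> \<sigma> small by (intro mult_left_mono exp_le_quadratic p(1)) auto
    finally show ?thesis .
  qed
  have low: "p * (1 - \<sigma>) \<le> (\<Prod>i\<in>I. a i - c i)"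
  proof -
    have "p * (1 - \<sigma>) \<le> p * (\<Prod>i\<in>I. 1 - c i / a i)"
      unfolding \<sigma>_def using c apos
      by (intro mult_left_mono Weierstrass_prod_ineq p(1)) (auto simp: divide_le_eq_1 less_imp_le)
    also have "\<dots> = (\<Prod>i\<in>I. a i * (1 - c i / a i))" by (simp add: prod.distrib p_def)
    also have "\<dots> = (\<Prod>i\<in>I. a i - c i)"
      using apos by (intro prod.cong refl) (simp add: field_simps less_imp_neq[symmetric])
    finally show ?thesis .
  qed
  have "(\<Prod>i\<in>I. a i + 2 * b i + c i) + (\<Prod>i\<in>I. a i - 2 * b i + c i) - 2 * (\<Prod>i\<in>I. a i - c i)
     \<le> p * (1 + (2 * \<mu> + \<sigma>) + (2 * \<mu> + \<sigma>)\<^sup>2) + p * (1 + (- 2 * \<mu> + \<sigma>) + (- 2 * \<mu> + \<sigma>)\<^sup>2)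
        - 2 * (p * (1 - \<sigma>))"
    using up[of 1] up[of "-1"] low by simp
  also have "\<dots> = p * (4 * \<sigma> + 8 * \<mu>\<^sup>2 + 2 * \<sigma>\<^sup>2)"
    by (simp add: algebra_simps power2_eq_square)
  also have "\<dots> \<le> 4 * \<sigma> + 8 * \<mu>\<^sup>2 + 2 * \<sigma>\<^sup>2"
    using p \<sigma> by (intro mult_left_le_one_le) auto
  also have "\<dots> \<le> 6 * s + 8 * m\<^sup>2"
  proof -
    have "\<sigma>\<^sup>2 \<le> \<sigma> * 1"
      unfolding power2_eq_square using \<sigma> small \<mu> by (intro mult_left_mono) auto
    moreover have "\<mu>\<^sup>2 \<le> m\<^sup>2" using \<mu> abs_le_square_iff[of \<mu> m] by auto
    ultimately show ?thesis using \<sigma> by linarith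
  qed
  finally show ?thesis .
qed

section \<open>One centred variable\<close>

text \<open>
  The angle is the truncation of \<open>y\<close> at level \<open>t\<close>, rescaled to the interval \<open>[-l, l]\<close>.
\<close>
definition phase :: "real \<Rightarrow> real \<Rightarrow> real \<Rightarrow> complex" where
  "phase t l y = iexp (l * y / (t * sqrt_weight t y))"

lemma phase_measurable [measurable]: "phase t l \<in> borel_measurable borel"
  unfolding phase_def[abs_def] by measurable

lemma norm_phase [simp]: "norm (phase t l y) = 1"
  unfolding phase_def by (simp add: norm_exp_i_times)

locale centred_unit_rv = prob_space M for M :: "'a measure" +
  fixes Y :: "'a \<Rightarrow> real" and t :: real
  assumes measurable_Y [measurable]: "Y \<in> borel_measurable M"
    and abs_Y_le_1: "\<And>\<omega>. \<omega> \<in> space M \<Longrightarrow> \<bar>Y \<omega>\<bar> \<le> 1"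
    and mean_zero: "expectation Y = 0"
    and t_pos: "t > 0"
begin

lemma integrable_bounded_image:
  fixes h :: "real \<Rightarrow> 'c::{banach, second_countable_topology}"
  assumes [measurable]: "h \<in> borel_measurable borel"
    and "\<And>y. \<bar>y\<bar> \<le> 1 \<Longrightarrow> norm (h y) \<le> c"
  shows "integrable M (\<lambda>\<omega>. h (Y \<omega>))"
  using assms(2) abs_Y_le_1 by (intro integrable_const_bound[where B=c] AE_I2) auto

abbreviation W :: "'a \<Rightarrow> real" where "W \<omega> \<equiv> sqrt_weight t (Y \<omega>)"

definition excess :: real where "excess = expectation W - 1"

lemma integrable_Y: "integrable M Y"
  using integrable_bounded_image[of "\<lambda>y. y" 1] by simp

lemma integrable_W: "integrable M W"
  by (rule integrable_bounded_image[of _ "sqrt (1 + 1 / t\<^sup>2)"])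
     (use sqrt_weight_le sqrt_weight_pos in \<open>auto simp: abs_of_pos\<close>)

lemma abs_div_weight_le: "\<bar>y\<bar> \<le> c \<Longrightarrow> \<bar>y / sqrt_weight t z\<bar> \<le> c"
  using sqrt_weight_ge_1[of t z]
  by (auto simp: abs_divide divide_le_eq) (smt (verit) abs_ge_zero mult_le_cancel_left1)

lemma integrable_div_W:
  assumes [measurable]: "h \<in> borel_measurable borel" and "\<And>y. \<bar>y\<bar> \<le> 1 \<Longrightarrow> \<bar>h y\<bar> \<le> c"
  shows "integrable M (\<lambda>\<omega>. h (Y \<omega>) / W \<omega>)"
  using assms(2) by (intro integrable_bounded_image[of "\<lambda>y. h y / sqrt_weight t y" c])
    (auto intro!: abs_div_weight_le simp del: abs_divide)

lemma integrable_div_weight: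
  "integrable M (\<lambda>\<omega>. 1 / W \<omega>)" "integrable M (\<lambda>\<omega>. Y \<omega> / W \<omega>)" "integrable M (\<lambda>\<omega>. (Y \<omega>)\<^sup>2 / W \<omega>)"
  using integrable_div_W[of "\<lambda>_. 1" 1] integrable_div_W[of "\<lambda>y. y" 1]
    integrable_div_W[of "\<lambda>y. y\<^sup>2" 1] by (simp_all add: abs_square_le_1)

lemma excess_nonneg: "0 \<le> excess"
  using integral_ge_const[OF integrable_W, of 1] sqrt_weight_ge_1 by (simp add: excess_def)

lemma expectation_inverse_weight:
  assumes "expectation W \<le> 2"
  shows "1/2 \<le> expectation (\<lambda>\<omega>. 1 / W \<omega>)" "expectation (\<lambda>\<omega>. 1 / W \<omega>) \<le> 1"
proof -
  have "expectation (\<lambda>\<omega>. 1 - W \<omega> / 4) \<le> expectation (\<lambda>\<omega>. 1 / W \<omega>)"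
    using integrable_W integrable_div_weight by (intro integral_mono inverse_sqrt_weight_ge) auto
  then show "1/2 \<le> expectation (\<lambda>\<omega>. 1 / W \<omega>)"
    using integrable_W assms by (simp add: prob_space)
  show "expectation (\<lambda>\<omega>. 1 / W \<omega>) \<le> 1"
    using integrable_div_weight(1) sqrt_weight_ge_1 by (intro integral_le_const) (auto simp: divide_le_eq_1)
qed

text \<open>
  Since \<open>Y\<close> is centred, the mean of its truncation is minus the mean of the part cut off.
\<close>
lemma abs_expectation_div_weight: "\<bar>expectation (\<lambda>\<omega>. Y \<omega> / W \<omega>)\<bar> \<le> t * excess"
proof -
  have "\<bar>expectation (\<lambda>\<omega>. Y \<omega> / W \<omega>)\<bar> = \<bar>expectation (\<lambda>\<omega>. Y \<omega> - Y \<omega> / W \<omega>)\<bar>"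
    using integrable_Y integrable_div_weight mean_zero by simp
  also have "\<dots> \<le> expectation (\<lambda>\<omega>. \<bar>Y \<omega> - Y \<omega> / W \<omega>\<bar>)"
    by (rule integral_abs_bound)
  also have "\<dots> \<le> expectation (\<lambda>\<omega>. t * (W \<omega> - 1))"
    using integrable_Y integrable_div_weight integrable_W t_pos
    by (intro integral_mono abs_diff_sqrt_weight integrable_abs integrable_diff integrable_mult_right) auto
  also have "\<dots> = t * excess"
    using integrable_W by (simp add: excess_def prob_space)
  finally show ?thesis .
qed

text \<open>
  Multiplied by \<open>l / t\<close> this is the correlation \<open>E (Y \<theta>)\<close> of \<open>Y\<close> with the angle
  \<open>\<theta> = l Y / (t W)\<close> of \<open>phase\<close>.
\<close>
definition energy :: real where "energy = expectation (\<lambda>\<omega>. (Y \<omega>)\<^sup>2 / W \<omega>)"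

lemma expectation_mult_energy: "expectation (\<lambda>\<omega>. k * ((Y \<omega>)\<^sup>2 / W \<omega>)) = k * energy"
  unfolding energy_def by (rule integral_mult_right_zero)

lemma energy_bounds: "t\<^sup>2 * excess \<le> energy" "energy \<le> 2 * t\<^sup>2 * excess"
proof -
  have "expectation (\<lambda>\<omega>. t\<^sup>2 * (W \<omega> - 1)) \<le> energy" unfolding energy_def
    using integrable_div_weight integrable_W t_pos
    by (intro integral_mono square_div_sqrt_weight_ge integrable_diff integrable_mult_right) auto
  then show "t\<^sup>2 * excess \<le> energy"
    using integrable_W by (simp add: excess_def prob_space)
  have "energy \<le> expectation (\<lambda>\<omega>. 2 * t\<^sup>2 * (W \<omega> - 1))" unfolding energy_def
    using integrable_div_weight integrable_W t_pos
    by (intro integral_mono square_div_sqrt_weight_le integrable_diff integrable_mult_right) auto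
  then show "energy \<le> 2 * t\<^sup>2 * excess"
    using integrable_W by (simp add: excess_def prob_space)
qed

lemma excess_le_second_moment: "excess \<le> expectation (\<lambda>\<omega>. (Y \<omega>)\<^sup>2) / t\<^sup>2 / 2"
proof -
  have i: "integrable M (\<lambda>\<omega>. (Y \<omega>)\<^sup>2)"
    by (rule integrable_bounded_image[of "\<lambda>y. y\<^sup>2" 1]) (auto simp: abs_square_le_1)
  have "expectation (\<lambda>\<omega>. W \<omega> - 1) \<le> expectation (\<lambda>\<omega>. (Y \<omega>)\<^sup>2 / t\<^sup>2 / 2)"
    using i integrable_W by (intro integral_mono sqrt_weight_minus_1_le) auto
  then show ?thesis using integrable_W by (simp add: excess_def prob_space)
qed

text \<open>
  A characteristic function of the truncated variable under the law with density \<open>1 + s Y\<close>. For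
  \<open>s = 1\<close> and \<open>s = -1\<close> the density is nonnegative.
\<close>
definition tilted_phase :: "real \<Rightarrow> real \<Rightarrow> complex" where
  "tilted_phase s l = expectation (\<lambda>\<omega>. of_real (1 + s * Y \<omega>) * phase t l (Y \<omega>))"

lemma integrable_tilted_phase:
  assumes "\<bar>s\<bar> = 1"
  shows "integrable M (\<lambda>\<omega>. of_real (1 + s * Y \<omega>) * phase t l (Y \<omega>))"
proof (rule integrable_bounded_image[of "\<lambda>y. of_real (1 + s * y) * phase t l y" 2])
  fix y :: real assume "\<bar>y\<bar> \<le> 1"
  moreover have "\<bar>1 + s * y\<bar> \<le> 1 + \<bar>s\<bar> * \<bar>y\<bar>" by (metis abs_mult abs_one abs_triangle_ineq)
  ultimately show "norm (of_real (1 + s * y) * phase t l y) \<le> 2"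
    using assms by (simp only: norm_mult norm_phase norm_of_real) simp
qed measurable

lemma norm_tilted_phase:
  assumes "\<bar>s\<bar> = 1"
  shows "norm (tilted_phase s l) \<le> 1"
proof -
  have "norm (tilted_phase s l) \<le> expectation (\<lambda>\<omega>. norm (of_real (1 + s * Y \<omega>) * phase t l (Y \<omega>)))"
    unfolding tilted_phase_def by (rule integral_norm_bound)
  also have "\<dots> = expectation (\<lambda>\<omega>. 1 + s * Y \<omega>)"
  proof (rule Bochner_Integration.integral_cong[OF refl])
    fix \<omega> assume "\<omega> \<in> space M"
    then have "0 \<le> 1 + s * Y \<omega>" using abs_Y_le_1[of \<omega>] assms by (auto simp: abs_if split: if_splits)
    then show "norm (of_real (1 + s * Y \<omega>) * phase t l (Y \<omega>)) = 1 + s * Y \<omega>"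
      by (simp only: norm_mult norm_phase norm_of_real) simp
  qed
  also have "\<dots> = 1" using integrable_Y mean_zero by (simp add: prob_space)
  finally show ?thesis .
qed

definition phase_remainder :: "real \<Rightarrow> real \<Rightarrow> complex" where
  "phase_remainder l y = phase t l y - 1 - \<i> * of_real (l * y / (t * sqrt_weight t y))"

lemma angle_bounds:
  assumes "0 \<le> l"
  shows "\<bar>l * y / (t * sqrt_weight t y)\<bar> \<le> l"
    and "\<bar>y\<bar> * \<bar>l * y / (t * sqrt_weight t y)\<bar> = l / t * (y\<^sup>2 / sqrt_weight t y)"
    and "(l * y / (t * sqrt_weight t y))\<^sup>2 \<le> l\<^sup>2 / t\<^sup>2 * (y\<^sup>2 / sqrt_weight t y)"
proof -
  define w where "w = sqrt_weight t y"
  have w: "w \<ge> 1" "\<bar>y\<bar> \<le> t * w"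
    using sqrt_weight_ge_1 abs_le_sqrt_weight[OF t_pos] by (auto simp: w_def)
  have tw: "t * w > 0" using w t_pos by auto
  have "\<bar>l * y / (t * w)\<bar> = l * (\<bar>y\<bar> / (t * w))"
    using assms tw by (simp only: abs_divide abs_mult[of l y] abs_of_nonneg abs_of_pos) simp
  also have "\<dots> \<le> l * 1" using assms tw w by (intro mult_left_mono) (auto simp: divide_le_eq_1)
  finally show "\<bar>l * y / (t * sqrt_weight t y)\<bar> \<le> l" by (simp add: w_def)
  have "\<bar>y\<bar> * \<bar>l * y / (t * w)\<bar> = l * (\<bar>y\<bar> * \<bar>y\<bar>) / (t * w)"
    using assms tw by (simp only: abs_divide abs_mult[of l y] abs_of_nonneg abs_of_pos) simp
  also have "\<bar>y\<bar> * \<bar>y\<bar> = y\<^sup>2" by (simp add: power2_eq_square)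
  finally show "\<bar>y\<bar> * \<bar>l * y / (t * sqrt_weight t y)\<bar> = l / t * (y\<^sup>2 / sqrt_weight t y)"
    by (simp add: w_def)
  have "(l * y / (t * w))\<^sup>2 = l\<^sup>2 / t\<^sup>2 * (y\<^sup>2 / w) * (1 / w)"
    by (simp add: power2_eq_square mult_ac)
  also have "\<dots> \<le> l\<^sup>2 / t\<^sup>2 * (y\<^sup>2 / w) * 1"
    using w by (intro mult_left_mono) (auto simp: divide_le_eq_1)
  finally show "(l * y / (t * sqrt_weight t y))\<^sup>2 \<le> l\<^sup>2 / t\<^sup>2 * (y\<^sup>2 / sqrt_weight t y)"
    by (simp add: w_def)
qed

lemma norm_phase_remainder: "norm (phase_remainder l y) \<le> (l * y / (t * sqrt_weight t y))\<^sup>2 / 2"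
  using iexp_approx1[of "l * y / (t * sqrt_weight t y)" 1]
  by (simp add: phase_remainder_def phase_def diff_diff_eq power2_eq_square numeral_2_eq_2)

lemma norm_phase_minus_1: "norm (phase t l y - 1) \<le> \<bar>l * y / (t * sqrt_weight t y)\<bar>"
  using iexp_approx1[of "l * y / (t * sqrt_weight t y)" 0]
  by (simp add: phase_def)

lemma integrable_phase_parts:
  assumes "0 \<le> l"
  shows "integrable M (\<lambda>\<omega>. phase_remainder l (Y \<omega>))"
    and "integrable M (\<lambda>\<omega>. of_real (Y \<omega>) * phase_remainder l (Y \<omega>))"
    and "integrable M (\<lambda>\<omega>. of_real (Y \<omega>) * (phase t l (Y \<omega>) - 1))"
proof -
  have *: "norm (phase_remainder l y) \<le> l\<^sup>2" for y
    using norm_phase_remainder[of l y] power_mono[OF angle_bounds(1)[OF assms, of y], of 2]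
      zero_le_power2[of l] unfolding power2_abs by linarith
  show "integrable M (\<lambda>\<omega>. phase_remainder l (Y \<omega>))"
    by (rule integrable_bounded_image[of "phase_remainder l" "l\<^sup>2"])
       (use * in \<open>auto simp: phase_remainder_def[abs_def]\<close>)
  have "norm (of_real y * phase_remainder l y) \<le> 1 * l\<^sup>2" if "\<bar>y\<bar> \<le> 1" for y :: real
    unfolding norm_mult norm_of_real using * that by (intro mult_mono) auto
  then show "integrable M (\<lambda>\<omega>. of_real (Y \<omega>) * phase_remainder l (Y \<omega>))"
    by (intro integrable_bounded_image[of "\<lambda>y. of_real y * phase_remainder l y" "1 * l\<^sup>2"])
       (auto simp: phase_remainder_def[abs_def])
  have "norm (of_real y * (phase t l y - 1)) \<le> 1 * l" if "\<bar>y\<bar> \<le> 1" for y :: real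
    unfolding norm_mult norm_of_real
    using that norm_phase_minus_1[of l y] angle_bounds(1)[OF assms, of y] by (intro mult_mono) auto
  then show "integrable M (\<lambda>\<omega>. of_real (Y \<omega>) * (phase t l (Y \<omega>) - 1))"
    by (intro integrable_bounded_image[of "\<lambda>y. of_real y * (phase t l y - 1)" "1 * l"]) auto
qed

lemma norm_expectation_mult_phase_minus_1:
  assumes "0 \<le> l"
  shows "norm (expectation (\<lambda>\<omega>. of_real (Y \<omega>) * (phase t l (Y \<omega>) - 1))) \<le> l * (energy / t)"
proof -
  have "norm (expectation (\<lambda>\<omega>. of_real (Y \<omega>) * (phase t l (Y \<omega>) - 1)))
      \<le> expectation (\<lambda>\<omega>. norm (of_real (Y \<omega>) * (phase t l (Y \<omega>) - 1)))"
    by (rule integral_norm_bound)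
  also have "\<dots> \<le> expectation (\<lambda>\<omega>. l / t * ((Y \<omega>)\<^sup>2 / W \<omega>))"
  proof (intro integral_mono integrable_norm integrable_phase_parts assms integrable_mult_right
      integrable_div_weight)
    fix \<omega>
    show "norm (of_real (Y \<omega>) * (phase t l (Y \<omega>) - 1)) \<le> l / t * ((Y \<omega>)\<^sup>2 / W \<omega>)"
      unfolding norm_mult norm_of_real angle_bounds(2)[OF assms, symmetric]
      by (intro mult_left_mono norm_phase_minus_1) auto
  qed
  also have "\<dots> = l * (energy / t)" by (simp only: expectation_mult_energy) simp
  finally show ?thesis .
qed

text \<open>
  The deviation from \<open>1\<close> has three parts: the mean of the angle, which is small because \<open>Y\<close> is
  centred; the second-order remainder of the exponential; and the contribution of the density,
  which is of order \<open>l t\<close> times the excess, so that \<open>t \<le> 1\<close> is what makes it as small as the others.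
\<close>
lemma norm_tilted_phase_minus_1:
  assumes "\<bar>s\<bar> = 1" "0 \<le> l" "l \<le> 1" "t \<le> 1"
  shows "norm (tilted_phase s l - 1) \<le> 4 * l * excess"
proof -
  have eq: "tilted_phase s l - 1 = \<i> * of_real (l / t * expectation (\<lambda>\<omega>. Y \<omega> / W \<omega>))
      + expectation (\<lambda>\<omega>. phase_remainder l (Y \<omega>))
      + of_real s * expectation (\<lambda>\<omega>. of_real (Y \<omega>) * (phase t l (Y \<omega>) - 1))"
  proof -
    define c g where "c = complex_of_real (l / t)" and "g \<omega> = complex_of_real (Y \<omega> / W \<omega>)" for \<omega>
    have g: "integrable M g" "expectation g = of_real (expectation (\<lambda>\<omega>. Y \<omega> / W \<omega>))"
      unfolding g_def[abs_def] using integrable_div_weight(2)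
      by (simp_all only: integrable_of_real integral_of_real)
    have "tilted_phase s l = expectation (\<lambda>\<omega>. 1 + \<i> * (c * g \<omega>)
      + phase_remainder l (Y \<omega>) + of_real s * (of_real (Y \<omega>) * (phase t l (Y \<omega>) - 1)) + of_real (s * Y \<omega>))"
      unfolding tilted_phase_def by (intro Bochner_Integration.integral_cong refl)
        (simp add: phase_remainder_def c_def g_def algebra_simps)
    also have "\<dots> = 1 + \<i> * of_real (l / t * expectation (\<lambda>\<omega>. Y \<omega> / W \<omega>))
      + expectation (\<lambda>\<omega>. phase_remainder l (Y \<omega>))
      + of_real s * expectation (\<lambda>\<omega>. of_real (Y \<omega>) * (phase t l (Y \<omega>) - 1)) + of_real (s * expectation Y)"
      using integrable_phase_parts[OF assms(2)] g integrable_Y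
      by (simp add: prob_space c_def)
    finally show ?thesis by (simp add: mean_zero)
  qed
  have 1: "norm (\<i> * complex_of_real (l / t * expectation (\<lambda>\<omega>. Y \<omega> / W \<omega>))) \<le> l * excess"
  proof -
    have "norm (\<i> * complex_of_real (l / t * expectation (\<lambda>\<omega>. Y \<omega> / W \<omega>)))
        = l / t * \<bar>expectation (\<lambda>\<omega>. Y \<omega> / W \<omega>)\<bar>"
      using assms t_pos by (simp add: norm_mult norm_divide)
    also have "\<dots> \<le> l / t * (t * excess)"
      using assms t_pos by (intro mult_left_mono abs_expectation_div_weight) auto
    finally show ?thesis using t_pos by simp
  qed
  have 2: "norm (expectation (\<lambda>\<omega>. phase_remainder l (Y \<omega>))) \<le> l * excess"
  proof -
    have "norm (expectation (\<lambda>\<omega>. phase_remainder l (Y \<omega>))) \<le> expectation (\<lambda>\<omega>. norm (phase_remainder l (Y \<omega>)))"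
      by (rule integral_norm_bound)
    also have "\<dots> \<le> expectation (\<lambda>\<omega>. l\<^sup>2 / t\<^sup>2 / 2 * ((Y \<omega>)\<^sup>2 / W \<omega>))"
    proof (intro integral_mono integrable_norm integrable_phase_parts assms integrable_mult_right
        integrable_div_weight)
      fix \<omega>
      show "norm (phase_remainder l (Y \<omega>)) \<le> l\<^sup>2 / t\<^sup>2 / 2 * ((Y \<omega>)\<^sup>2 / W \<omega>)"
        using norm_phase_remainder[of l "Y \<omega>"] angle_bounds(3)[OF assms(2), of "Y \<omega>"] by simp
    qed
    also have "\<dots> = l\<^sup>2 / t\<^sup>2 / 2 * energy" by (rule expectation_mult_energy)
    also have "\<dots> \<le> l\<^sup>2 / t\<^sup>2 / 2 * (2 * t\<^sup>2 * excess)"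
      by (intro mult_left_mono energy_bounds) auto
    also have "\<dots> = l * (l * excess)" using t_pos by (simp add: power2_eq_square)
    also have "\<dots> \<le> 1 * (l * excess)"
      using assms excess_nonneg by (intro mult_right_mono) auto
    finally show ?thesis by simp
  qed
  have 3: "norm (of_real s * expectation (\<lambda>\<omega>. of_real (Y \<omega>) * (phase t l (Y \<omega>) - 1))) \<le> 2 * l * excess"
  proof -
    have "norm (of_real s * expectation (\<lambda>\<omega>. of_real (Y \<omega>) * (phase t l (Y \<omega>) - 1))) \<le> l * (energy / t)"
      using norm_expectation_mult_phase_minus_1[OF assms(2)] assms(1) by (simp add: norm_mult)
    also have "\<dots> \<le> l * (2 * t\<^sup>2 * excess / t)"
      using assms t_pos energy_bounds by (intro mult_left_mono divide_right_mono) auto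
    also have "\<dots> = t * (2 * l * excess)" using t_pos by (simp add: power2_eq_square)
    also have "\<dots> \<le> 1 * (2 * l * excess)"
      using assms excess_nonneg by (intro mult_right_mono) auto
    finally show ?thesis by simp
  qed
  show ?thesis unfolding eq
    using norm_triangle_le[OF add_mono[OF norm_triangle_le[OF add_mono[OF 1 2]] 3]] by simp
qed

text \<open>
  The difference of the two tilts is \<open>2 E (Y (exp (\<i> \<theta>) - 1))\<close>. Its leading term \<open>2\<i> E (Y \<theta>)\<close> is purely
  imaginary with a nonnegative imaginary part, because \<open>\<theta>\<close> has the sign of \<open>Y\<close>; hence such terms cannot
  cancel when several variables are combined.
\<close>
lemma tilted_phase_difference:
  assumes "0 \<le> l"
  shows "norm (tilted_phase 1 l - tilted_phase (-1) l) \<le> 2 * l * (energy / t)"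
    and "norm (tilted_phase 1 l - tilted_phase (-1) l - \<i> * of_real (2 * l * (energy / t)))
      \<le> l\<^sup>2 * (energy / t)"
proof -
  have eq: "tilted_phase 1 l - tilted_phase (-1) l
      = 2 * expectation (\<lambda>\<omega>. of_real (Y \<omega>) * (phase t l (Y \<omega>) - 1))"
  proof -
    have "tilted_phase 1 l - tilted_phase (-1) l
        = expectation (\<lambda>\<omega>. of_real (1 + 1 * Y \<omega>) * phase t l (Y \<omega>) - of_real (1 + (-1) * Y \<omega>) * phase t l (Y \<omega>))"
      unfolding tilted_phase_def
      by (intro Bochner_Integration.integral_diff[symmetric] integrable_tilted_phase) auto
    also have "\<dots> = expectation (\<lambda>\<omega>. 2 * (of_real (Y \<omega>) * (phase t l (Y \<omega>) - 1)) + of_real (2 * Y \<omega>))"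
      by (intro Bochner_Integration.integral_cong refl) (simp add: algebra_simps)
    also have "\<dots> = 2 * expectation (\<lambda>\<omega>. of_real (Y \<omega>) * (phase t l (Y \<omega>) - 1)) + of_real (2 * expectation Y)"
      using integrable_phase_parts[OF assms] integrable_Y by (simp del: of_real_mult)
    finally show ?thesis by (simp add: mean_zero)
  qed
  show "norm (tilted_phase 1 l - tilted_phase (-1) l) \<le> 2 * l * (energy / t)"
    unfolding eq using norm_expectation_mult_phase_minus_1[OF assms] by (simp add: norm_mult)
  have split: "expectation (\<lambda>\<omega>. of_real (Y \<omega>) * (phase t l (Y \<omega>) - 1))
      = expectation (\<lambda>\<omega>. of_real (Y \<omega>) * phase_remainder l (Y \<omega>)) + \<i> * of_real (l * (energy / t))"
  proof -
    define c g where "c = complex_of_real (l / t)" and "g \<omega> = complex_of_real ((Y \<omega>)\<^sup>2 / W \<omega>)" for \<omega>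
    have g: "integrable M g" "expectation g = of_real energy"
      unfolding g_def[abs_def] energy_def using integrable_div_weight(3)
      by (simp_all only: integrable_of_real integral_of_real)
    have "expectation (\<lambda>\<omega>. of_real (Y \<omega>) * (phase t l (Y \<omega>) - 1))
       = expectation (\<lambda>\<omega>. of_real (Y \<omega>) * phase_remainder l (Y \<omega>) + \<i> * (c * g \<omega>))"
      by (intro Bochner_Integration.integral_cong refl)
         (simp add: phase_remainder_def c_def g_def algebra_simps power2_eq_square)
    also have "\<dots> = expectation (\<lambda>\<omega>. of_real (Y \<omega>) * phase_remainder l (Y \<omega>)) + \<i> * (c * of_real energy)"
      using integrable_phase_parts[OF assms] g by simp
    finally show ?thesis by (simp add: c_def)
  qed
  have "norm (expectation (\<lambda>\<omega>. of_real (Y \<omega>) * phase_remainder l (Y \<omega>)))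
      \<le> expectation (\<lambda>\<omega>. norm (of_real (Y \<omega>) * phase_remainder l (Y \<omega>)))"
    by (rule integral_norm_bound)
  also have "\<dots> \<le> expectation (\<lambda>\<omega>. l\<^sup>2 / t / 2 * ((Y \<omega>)\<^sup>2 / W \<omega>))"
  proof (intro integral_mono integrable_norm integrable_phase_parts assms integrable_mult_right
      integrable_div_weight)
    fix \<omega>
    define \<theta> where "\<theta> = l * Y \<omega> / (t * W \<omega>)"
    have "norm (of_real (Y \<omega>) * phase_remainder l (Y \<omega>)) \<le> \<bar>Y \<omega>\<bar> * (\<theta>\<^sup>2 / 2)"
      unfolding norm_mult norm_of_real \<theta>_def by (intro mult_left_mono norm_phase_remainder) auto
    also have "\<dots> = \<bar>Y \<omega>\<bar> * \<bar>\<theta>\<bar> * \<bar>\<theta>\<bar> / 2" by (simp add: power2_eq_square)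
    also have "\<dots> \<le> \<bar>Y \<omega>\<bar> * \<bar>\<theta>\<bar> * l / 2"
      unfolding \<theta>_def using angle_bounds(1)[OF assms, of "Y \<omega>"]
      by (intro divide_right_mono mult_left_mono) auto
    also have "\<dots> = l\<^sup>2 / t / 2 * ((Y \<omega>)\<^sup>2 / W \<omega>)"
      unfolding \<theta>_def angle_bounds(2)[OF assms] by (simp add: power2_eq_square mult_ac)
    finally show "norm (of_real (Y \<omega>) * phase_remainder l (Y \<omega>)) \<le> l\<^sup>2 / t / 2 * ((Y \<omega>)\<^sup>2 / W \<omega>)" .
  qed
  also have "\<dots> = l\<^sup>2 / t / 2 * energy" by (rule expectation_mult_energy)
  finally show "norm (tilted_phase 1 l - tilted_phase (-1) l - \<i> * of_real (2 * l * (energy / t)))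
      \<le> l\<^sup>2 * (energy / t)"
    unfolding eq split by (simp add: algebra_simps norm_mult)
qed

end

section \<open>Independent centred variables\<close>

lemma real_sqrt_prod: "sqrt (\<Prod>i\<in>I. f i) = (\<Prod>i\<in>I. sqrt (f i))"
  by (induction I rule: infinite_finite_induct) (simp_all add: real_sqrt_mult)

locale centred_unit_family = prob_space M for M :: "'a measure" +
  fixes I :: "'i set" and U :: "'i \<Rightarrow> 'a \<Rightarrow> real"
  assumes finite_I [simp]: "finite I"
    and indep: "indep_vars (\<lambda>_. borel) U I"
    and abs_U_le_1: "\<And>i \<omega>. i \<in> I \<Longrightarrow> \<omega> \<in> space M \<Longrightarrow> \<bar>U i \<omega>\<bar> \<le> 1"
    and mean_U: "\<And>i. i \<in> I \<Longrightarrow> expectation (U i) = 0"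
begin

lemma measurable_U: "i \<in> I \<Longrightarrow> U i \<in> borel_measurable M"
  using indep unfolding indep_vars_def2 by auto

lemma coordinate: "i \<in> I \<Longrightarrow> t > 0 \<Longrightarrow> centred_unit_rv M (U i) t"
  using measurable_U abs_U_le_1 mean_U
  by (intro centred_unit_rv.intro centred_unit_rv_axioms.intro prob_space_axioms) auto

lemma expectation_prod:
  fixes h :: "real \<Rightarrow> 'c::{real_normed_field, banach, second_countable_topology}"
  assumes "h \<in> borel_measurable borel" "\<And>i. i \<in> I \<Longrightarrow> integrable M (\<lambda>\<omega>. h (U i \<omega>))"
  shows "expectation (\<lambda>\<omega>. \<Prod>i\<in>I. h (U i \<omega>)) = (\<Prod>i\<in>I. expectation (\<lambda>\<omega>. h (U i \<omega>)))"
    and "integrable M (\<lambda>\<omega>. \<Prod>i\<in>I. h (U i \<omega>))"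
  using indep_vars_lebesgue_integral[of I "\<lambda>i \<omega>. h (U i \<omega>)"]
    indep_vars_integrable[of I "\<lambda>i \<omega>. h (U i \<omega>)"]
    indep_vars_compose2[OF indep, of "\<lambda>_. h" "\<lambda>_. borel"] assms by auto

text \<open>\<open>tilt 1\<close> and \<open>tilt (-1)\<close> are the densities of the two product measures.\<close>
definition tilt :: "real \<Rightarrow> 'a \<Rightarrow> real" where
  "tilt s \<omega> = (\<Prod>i\<in>I. 1 + s * U i \<omega>)"

lemma tilt_nonneg: "\<omega> \<in> space M \<Longrightarrow> \<bar>s\<bar> = 1 \<Longrightarrow> 0 \<le> tilt s \<omega>"
  unfolding tilt_def
proof (rule prod_nonneg)
  fix i assume "\<omega> \<in> space M" "\<bar>s\<bar> = 1" "i \<in> I"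
  then show "0 \<le> 1 + s * U i \<omega>"
    using abs_U_le_1[of i \<omega>] by (auto simp: abs_if split: if_splits)
qed

lemma integrable_U: "i \<in> I \<Longrightarrow> integrable M (U i)"
  using centred_unit_rv.integrable_Y[OF coordinate, of i 1] by simp

lemma integrable_tilt: "integrable M (tilt s)"
  using expectation_prod(2)[of "\<lambda>y. 1 + s * y"] integrable_U by (simp add: tilt_def[abs_def])

lemma expectation_tilt: "expectation (tilt s) = 1"
  using expectation_prod(1)[of "\<lambda>y. 1 + s * y"] integrable_U mean_U
  by (simp add: tilt_def[abs_def] prob_space)

definition tilt_distance :: real where
  "tilt_distance = expectation (\<lambda>\<omega>. \<bar>tilt 1 \<omega> - tilt (-1) \<omega>\<bar>)"

lemma tilt_distance_le_2: "tilt_distance \<le> 2"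
proof -
  have "tilt_distance \<le> expectation (\<lambda>\<omega>. tilt 1 \<omega> + tilt (-1) \<omega>)"
    unfolding tilt_distance_def
  proof (rule integral_mono)
    fix \<omega> assume "\<omega> \<in> space M"
    then show "\<bar>tilt 1 \<omega> - tilt (-1) \<omega>\<bar> \<le> tilt 1 \<omega> + tilt (-1) \<omega>"
      using tilt_nonneg[of \<omega> 1] tilt_nonneg[of \<omega> "-1"] by simp
  qed (use integrable_tilt in auto)
  then show ?thesis using integrable_tilt by (simp add: expectation_tilt)
qed

definition log_weight_sum :: "real \<Rightarrow> real" where
  "log_weight_sum t = (\<Sum>i\<in>I. ln (expectation (\<lambda>\<omega>. sqrt_weight t (U i \<omega>))))"

abbreviation excess :: "real \<Rightarrow> 'i \<Rightarrow> real" where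
  "excess t i \<equiv> centred_unit_rv.excess M (U i) t"

abbreviation energy :: "real \<Rightarrow> 'i \<Rightarrow> real" where
  "energy t i \<equiv> centred_unit_rv.energy M (U i) t"

context
  fixes T :: real
  assumes T_pos: "T > 0" and T: "log_weight_sum T = 1/2"
begin

abbreviation EW :: "'i \<Rightarrow> real" where
  "EW i \<equiv> expectation (\<lambda>\<omega>. sqrt_weight T (U i \<omega>))"

lemma EW_eq: "i \<in> I \<Longrightarrow> EW i = 1 + excess T i"
  using centred_unit_rv.excess_def[OF coordinate[OF _ T_pos]] by simp

lemma excess_nonneg: "i \<in> I \<Longrightarrow> 0 \<le> excess T i"
  using centred_unit_rv.excess_nonneg[OF coordinate[OF _ T_pos]] .

lemma prod_EW: "(\<Prod>i\<in>I. EW i) \<le> 2"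
proof -
  have "exp (\<Sum>i\<in>I. ln (EW i)) = (\<Prod>i\<in>I. EW i)"
    unfolding exp_sum[OF finite_I] using excess_nonneg EW_eq
    by (intro prod.cong refl exp_ln) (auto intro: add_pos_nonneg)
  then show ?thesis using T exp_half_le2 unfolding log_weight_sum_def by simp
qed

lemma EW_le_2:
  assumes "i \<in> I"
  shows "EW i \<le> 2"
proof -
  have "ln (EW i) \<le> (\<Sum>i\<in>I. ln (EW i))"
    using assms excess_nonneg EW_eq by (intro member_le_sum) auto
  then have "ln (EW i) \<le> 1/2" using T unfolding log_weight_sum_def by simp
  moreover have "EW i > 0" using excess_nonneg[OF assms] EW_eq[OF assms] by linarith
  ultimately have "EW i \<le> exp (1/2)" by (metis exp_le_cancel_iff exp_ln)
  then show ?thesis using exp_half_le2 by linarith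
qed

lemma sum_excess_le: "(\<Sum>i\<in>I. excess T i) \<le> 2"
proof -
  have "(\<Sum>i\<in>I. excess T i) \<le> (\<Prod>i\<in>I. 1 + excess T i)"
    by (rule sum_le_prod) (rule excess_nonneg)
  also have "\<dots> = (\<Prod>i\<in>I. EW i)" using EW_eq by (intro prod.cong) auto
  finally show ?thesis using prod_EW by linarith
qed

lemma sum_excess_ge: "1/2 \<le> (\<Sum>i\<in>I. excess T i)"
proof -
  have "(\<Sum>i\<in>I. ln (EW i)) \<le> (\<Sum>i\<in>I. excess T i)"
    using excess_nonneg EW_eq by (intro sum_mono) (auto intro!: ln_add_one_self_le_self)
  then show ?thesis using T unfolding log_weight_sum_def by simp
qed

text \<open>
  Each of \<open>(1 + U)\<^sup>2\<close>, \<open>(1 - U)\<^sup>2\<close> and \<open>(1 + U) (1 - U)\<close> is a quadratic \<open>1 + 2 s U + r U\<^sup>2\<close>, so a single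
  computation of its weighted mean covers the three products in the expansion of the square.
\<close>
lemma weighted_square_distance:
  assumes "T \<le> 1/10"
  defines "w \<equiv> \<lambda>\<omega>. \<Prod>i\<in>I. sqrt_weight T (U i \<omega>)"
  shows "integrable M (\<lambda>\<omega>. (tilt 1 \<omega> - tilt (-1) \<omega>)\<^sup>2 / w \<omega>)"
    and "expectation (\<lambda>\<omega>. (tilt 1 \<omega> - tilt (-1) \<omega>)\<^sup>2 / w \<omega>) \<le> 176 * T\<^sup>2"
proof -
  define \<alpha> \<beta> where "\<alpha> i = expectation (\<lambda>\<omega>. 1 / sqrt_weight T (U i \<omega>))"
    and "\<beta> i = expectation (\<lambda>\<omega>. U i \<omega> / sqrt_weight T (U i \<omega>))" for i
  note crd = coordinate[OF _ T_pos]
  note int = centred_unit_rv.integrable_div_weight[OF crd]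
  have quad: "integrable M (\<lambda>\<omega>. (1 + 2 * s * U i \<omega> + r * (U i \<omega>)\<^sup>2) / sqrt_weight T (U i \<omega>))"
    "expectation (\<lambda>\<omega>. (1 + 2 * s * U i \<omega> + r * (U i \<omega>)\<^sup>2) / sqrt_weight T (U i \<omega>))
      = \<alpha> i + 2 * s * \<beta> i + r * energy T i" if "i \<in> I" for i s r
  proof -
    have eq: "(\<lambda>\<omega>. (1 + 2 * s * U i \<omega> + r * (U i \<omega>)\<^sup>2) / sqrt_weight T (U i \<omega>))
      = (\<lambda>\<omega>. 1 / sqrt_weight T (U i \<omega>) + (2 * s) * (U i \<omega> / sqrt_weight T (U i \<omega>))
          + r * ((U i \<omega>)\<^sup>2 / sqrt_weight T (U i \<omega>)))"
      by (simp add: add_divide_distrib)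
    note ints = int(1)[OF that] integrable_mult_right[OF int(2)[OF that], of "2 * s"]
      integrable_mult_right[OF int(3)[OF that], of r]
    show "integrable M (\<lambda>\<omega>. (1 + 2 * s * U i \<omega> + r * (U i \<omega>)\<^sup>2) / sqrt_weight T (U i \<omega>))"
      unfolding eq by (intro Bochner_Integration.integrable_add ints)
    show "expectation (\<lambda>\<omega>. (1 + 2 * s * U i \<omega> + r * (U i \<omega>)\<^sup>2) / sqrt_weight T (U i \<omega>))
      = \<alpha> i + 2 * s * \<beta> i + r * energy T i"
      unfolding eq \<alpha>_def \<beta>_def centred_unit_rv.energy_def[OF crd[OF that]]
      by (simp only: ints Bochner_Integration.integrable_add Bochner_Integration.integral_add integral_mult_right_zero)
  qed
  have prods: "integrable M (\<lambda>\<omega>. \<Prod>i\<in>I. (1 + 2 * s * U i \<omega> + r * (U i \<omega>)\<^sup>2) / sqrt_weight T (U i \<omega>))"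
    "expectation (\<lambda>\<omega>. \<Prod>i\<in>I. (1 + 2 * s * U i \<omega> + r * (U i \<omega>)\<^sup>2) / sqrt_weight T (U i \<omega>))
      = (\<Prod>i\<in>I. \<alpha> i + 2 * s * \<beta> i + r * energy T i)" for s r
    using expectation_prod[of "\<lambda>y. (1 + 2 * s * y + r * y\<^sup>2) / sqrt_weight T y"] quad by auto
  have expand: "(\<lambda>\<omega>. (tilt 1 \<omega> - tilt (-1) \<omega>)\<^sup>2 / w \<omega>) = (\<lambda>\<omega>.
      (\<Prod>i\<in>I. (1 + 2 * 1 * U i \<omega> + 1 * (U i \<omega>)\<^sup>2) / sqrt_weight T (U i \<omega>))
    + (\<Prod>i\<in>I. (1 + 2 * (-1) * U i \<omega> + 1 * (U i \<omega>)\<^sup>2) / sqrt_weight T (U i \<omega>))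
    - 2 * (\<Prod>i\<in>I. (1 + 2 * 0 * U i \<omega> + (-1) * (U i \<omega>)\<^sup>2) / sqrt_weight T (U i \<omega>)))"
  proof
    fix \<omega>
    have "(\<Prod>i\<in>I. (1 + 2 * 1 * U i \<omega> + 1 * (U i \<omega>)\<^sup>2) / sqrt_weight T (U i \<omega>)) = (tilt 1 \<omega>)\<^sup>2 / w \<omega>"
      "(\<Prod>i\<in>I. (1 + 2 * (-1) * U i \<omega> + 1 * (U i \<omega>)\<^sup>2) / sqrt_weight T (U i \<omega>)) = (tilt (-1) \<omega>)\<^sup>2 / w \<omega>"
      "(\<Prod>i\<in>I. (1 + 2 * 0 * U i \<omega> + (-1) * (U i \<omega>)\<^sup>2) / sqrt_weight T (U i \<omega>)) = tilt 1 \<omega> * tilt (-1) \<omega> / w \<omega>"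
      unfolding w_def tilt_def prod_dividef power2_eq_square prod.distrib[symmetric]
      by (intro arg_cong2[where f="(/)"] prod.cong refl; simp add: algebra_simps)+
    then show "(tilt 1 \<omega> - tilt (-1) \<omega>)\<^sup>2 / w \<omega> =
      (\<Prod>i\<in>I. (1 + 2 * 1 * U i \<omega> + 1 * (U i \<omega>)\<^sup>2) / sqrt_weight T (U i \<omega>))
    + (\<Prod>i\<in>I. (1 + 2 * (-1) * U i \<omega> + 1 * (U i \<omega>)\<^sup>2) / sqrt_weight T (U i \<omega>))
    - 2 * (\<Prod>i\<in>I. (1 + 2 * 0 * U i \<omega> + (-1) * (U i \<omega>)\<^sup>2) / sqrt_weight T (U i \<omega>))"
      by (simp only:) (simp add: power2_eq_square algebra_simps diff_divide_distrib add_divide_distrib)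
  qed
  show "integrable M (\<lambda>\<omega>. (tilt 1 \<omega> - tilt (-1) \<omega>)\<^sup>2 / w \<omega>)"
    unfolding expand by (intro Bochner_Integration.integrable_add Bochner_Integration.integrable_diff integrable_mult_right prods)
  have "expectation (\<lambda>\<omega>. (tilt 1 \<omega> - tilt (-1) \<omega>)\<^sup>2 / w \<omega>)
    = (\<Prod>i\<in>I. \<alpha> i + 2 * \<beta> i + energy T i) + (\<Prod>i\<in>I. \<alpha> i - 2 * \<beta> i + energy T i)
      - 2 * (\<Prod>i\<in>I. \<alpha> i - energy T i)"
    unfolding expand using prods[of 1 1] prods[of "-1" 1] prods[of 0 "-1"] by simp
  also have "\<dots> \<le> 6 * (8 * T\<^sup>2) + 8 * (4 * T)\<^sup>2"
  proof (rule prod_second_difference_le)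
    fix i assume i: "i \<in> I"
    show "1/2 \<le> \<alpha> i" "\<alpha> i \<le> 1"
      unfolding \<alpha>_def using centred_unit_rv.expectation_inverse_weight[OF crd[OF i] EW_le_2[OF i]] by auto
    have "0 \<le> expectation (\<lambda>\<omega>. (U i \<omega>)\<^sup>2 / sqrt_weight T (U i \<omega>))"
      using sqrt_weight_pos by (intro integral_nonneg_AE AE_I2) (auto intro!: divide_nonneg_pos)
    then show "0 \<le> energy T i" by (simp add: centred_unit_rv.energy_def[OF crd[OF i]])
    have nn: "0 \<le> \<alpha> i + 2 * s * \<beta> i + r * energy T i"
      if "\<And>y::real. \<bar>y\<bar> \<le> 1 \<Longrightarrow> 0 \<le> 1 + 2 * s * y + r * y\<^sup>2" for s r
      unfolding quad(2)[OF i, symmetric]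
    proof (intro integral_nonneg_AE AE_I2)
      fix \<omega> assume "\<omega> \<in> space M"
      then show "0 \<le> (1 + 2 * s * U i \<omega> + r * (U i \<omega>)\<^sup>2) / sqrt_weight T (U i \<omega>)"
        using that[OF abs_U_le_1[OF i]] sqrt_weight_pos[of T "U i \<omega>"] by auto
    qed
    have *: "0 \<le> 1 + 2 * s * y + 1 * y\<^sup>2" if "\<bar>s\<bar> = 1" for s y :: real
    proof -
      have "s\<^sup>2 = 1" using that power2_abs[of s] by simp
      then have "1 + 2 * s * y + 1 * y\<^sup>2 = (s + y)\<^sup>2" by (simp add: power2_sum)
      then show ?thesis by simp
    qed
    have "0 \<le> \<alpha> i + 2 * 1 * \<beta> i + 1 * energy T i" "0 \<le> \<alpha> i + 2 * (-1) * \<beta> i + 1 * energy T i"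
      by (rule nn, rule *, simp)+
    then show "2 * \<bar>\<beta> i\<bar> \<le> \<alpha> i + energy T i" by (simp add: abs_if)
    have "0 \<le> \<alpha> i + 2 * 0 * \<beta> i + (-1) * energy T i"
      by (rule nn) (simp add: abs_square_le_1)
    then show "energy T i \<le> \<alpha> i" by simp
  next
    have "(\<Sum>i\<in>I. \<bar>\<beta> i\<bar>) \<le> (\<Sum>i\<in>I. T * excess T i)"
      unfolding \<beta>_def by (intro sum_mono centred_unit_rv.abs_expectation_div_weight crd)
    also have "\<dots> \<le> T * 2"
      unfolding sum_distrib_left[symmetric] using T_pos sum_excess_le by (intro mult_left_mono) auto
    finally show "2 * (\<Sum>i\<in>I. \<bar>\<beta> i\<bar>) \<le> 4 * T" by simp
    have "(\<Sum>i\<in>I. energy T i) \<le> (\<Sum>i\<in>I. 2 * T\<^sup>2 * excess T i)"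
      by (intro sum_mono centred_unit_rv.energy_bounds crd)
    also have "\<dots> \<le> 2 * T\<^sup>2 * 2"
      unfolding sum_distrib_left[symmetric] using T_pos sum_excess_le by (intro mult_left_mono) auto
    finally show "2 * (\<Sum>i\<in>I. energy T i) \<le> 8 * T\<^sup>2" by simp
    have "T * T \<le> 1/10 * (1/10)" using assms T_pos by (intro mult_mono) auto
    then show "2 * (4 * T) + 8 * T\<^sup>2 \<le> 1" using assms by (simp add: power2_eq_square)
  qed
  finally show "expectation (\<lambda>\<omega>. (tilt 1 \<omega> - tilt (-1) \<omega>)\<^sup>2 / w \<omega>) \<le> 176 * T\<^sup>2"
    by (simp add: power_mult_distrib)
qed

text \<open>
  For \<open>T > 1/10\<close> the trivial bound \<open>2\<close> suffices. Otherwise the factor \<open>9 T\<close> in the weighted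
  inequality between arithmetic and geometric means nearly balances the two resulting terms.
\<close>
lemma tilt_distance_upper: "tilt_distance \<le> 20 * min 1 T"
proof (cases "T \<le> 1/10")
  case False
  then show ?thesis using tilt_distance_le_2 by auto
next
  case True
  define w where "w \<omega> = (\<Prod>i\<in>I. sqrt_weight T (U i \<omega>))" for \<omega>
  define z where "z \<omega> = tilt 1 \<omega> - tilt (-1) \<omega>" for \<omega>
  note sq = weighted_square_distance[OF True, folded w_def z_def]
  have w: "expectation w \<le> 2" "integrable M w"
    using expectation_prod[OF sqrt_weight_measurable, of T] prod_EW
      centred_unit_rv.integrable_W[OF coordinate[OF _ T_pos]] by (auto simp: w_def[abs_def])
  have w_pos: "w \<omega> > 0" for \<omega>
    unfolding w_def by (intro prod_pos) (simp add: sqrt_weight_pos)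
  have amgm: "\<bar>z \<omega>\<bar> \<le> 1 / (18 * T) * ((z \<omega>)\<^sup>2 / w \<omega>) + 9 * T / 2 * w \<omega>" for \<omega>
  proof -
    have "0 \<le> (\<bar>z \<omega>\<bar> - 9 * T * w \<omega>)\<^sup>2 / (18 * T * w \<omega>)"
      using T_pos w_pos[of \<omega>] by simp
    also have "\<dots> = 1 / (18 * T) * ((z \<omega>)\<^sup>2 / w \<omega>) + 9 * T / 2 * w \<omega> - \<bar>z \<omega>\<bar>"
      using T_pos w_pos[of \<omega>] by (simp add: power2_diff field_simps) (simp add: power2_eq_square)
    finally show ?thesis by simp
  qed
  have "tilt_distance = expectation (\<lambda>\<omega>. \<bar>z \<omega>\<bar>)" by (simp add: tilt_distance_def z_def)
  also have "\<dots> \<le> expectation (\<lambda>\<omega>. 1 / (18 * T) * ((z \<omega>)\<^sup>2 / w \<omega>) + 9 * T / 2 * w \<omega>)"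
    using integrable_tilt sq(1) w(2)
    by (intro integral_mono amgm Bochner_Integration.integrable_add integrable_mult_right integrable_abs)
       (simp_all add: z_def[abs_def])
  also have "\<dots> = 1 / (18 * T) * expectation (\<lambda>\<omega>. (z \<omega>)\<^sup>2 / w \<omega>) + 9 * T / 2 * expectation w"
    using sq(1) w(2) by (simp only: integrable_mult_right Bochner_Integration.integral_add integral_mult_right_zero)
  also have "\<dots> \<le> 1 / (18 * T) * (176 * T\<^sup>2) + 9 * T / 2 * 2"
    using T_pos sq(2) w(1) by (intro add_mono mult_left_mono) auto
  also have "\<dots> \<le> 20 * T" using T_pos by (simp add: power2_eq_square)
  finally show ?thesis using True by simp
qed

text \<open>
  With \<open>D = \<Sum>\<gamma>\<^sub>i / T\<close>, the main term has modulus \<open>2 l D\<close> and the errors are at most \<open>17 l\<^sup>2 D\<close>. Any \<open>l\<close> well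
  below \<open>2/17\<close> works, and \<open>l = 1/20\<close> is near the optimum \<open>1/17\<close>.
\<close>
lemma tilt_distance_lower_small:
  assumes "T \<le> 1"
  shows "T / 40 \<le> tilt_distance"
proof -
  define l :: real where "l = 1/20"
  have l: "0 \<le> l" "l \<le> 1" by (auto simp: l_def)
  define A where "A s i = centred_unit_rv.tilted_phase M (U i) T s l" for s i
  define ph where "ph = phase T l"
  define D where "D = (\<Sum>i\<in>I. energy T i / T)"
  note crd = coordinate[OF _ T_pos]
  have D: "T / 2 \<le> D"
  proof -
    have "T * (1/2) \<le> T * (\<Sum>i\<in>I. excess T i)"
      using T_pos sum_excess_ge by (intro mult_left_mono) auto
    also have "\<dots> \<le> D"
      unfolding D_def sum_distrib_left
    proof (rule sum_mono)
      fix i assume "i \<in> I"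
      from centred_unit_rv.energy_bounds(1)[OF crd[OF this]]
      show "T * excess T i \<le> energy T i / T"
        using T_pos by (simp add: le_divide_eq power2_eq_square mult_ac)
    qed
    finally show ?thesis by simp
  qed
  have tilted: "expectation (\<lambda>\<omega>. of_real (tilt s \<omega>) * (\<Prod>i\<in>I. ph (U i \<omega>))) = (\<Prod>i\<in>I. A s i)"
    "integrable M (\<lambda>\<omega>. of_real (tilt s \<omega>) * (\<Prod>i\<in>I. ph (U i \<omega>)))"
    if s: "\<bar>s\<bar> = 1" for s
  proof -
    have eq: "(\<lambda>\<omega>. of_real (tilt s \<omega>) * (\<Prod>i\<in>I. ph (U i \<omega>)))
      = (\<lambda>\<omega>. \<Prod>i\<in>I. of_real (1 + s * U i \<omega>) * ph (U i \<omega>))"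
      by (simp add: tilt_def prod.distrib)
    have i: "integrable M (\<lambda>\<omega>. of_real (1 + s * U i \<omega>) * ph (U i \<omega>))" if "i \<in> I" for i
      unfolding ph_def by (rule centred_unit_rv.integrable_tilted_phase[OF crd[OF that] s])
    have A: "A s i = expectation (\<lambda>\<omega>. of_real (1 + s * U i \<omega>) * ph (U i \<omega>))" if "i \<in> I" for i
      unfolding A_def ph_def by (rule centred_unit_rv.tilted_phase_def[OF crd[OF that]])
    have m: "(\<lambda>y. of_real (1 + s * y) * ph y) \<in> borel_measurable borel"
      unfolding ph_def by measurable
    show "expectation (\<lambda>\<omega>. of_real (tilt s \<omega>) * (\<Prod>i\<in>I. ph (U i \<omega>))) = (\<Prod>i\<in>I. A s i)"
      unfolding eq using expectation_prod(1)[OF m i] A by (simp cong: prod.cong)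
    show "integrable M (\<lambda>\<omega>. of_real (tilt s \<omega>) * (\<Prod>i\<in>I. ph (U i \<omega>)))"
      unfolding eq using expectation_prod(2)[OF m i] by simp
  qed
  have upper: "norm ((\<Prod>i\<in>I. A 1 i) - (\<Prod>i\<in>I. A (-1) i)) \<le> tilt_distance"
  proof -
    have "(\<Prod>i\<in>I. A 1 i) - (\<Prod>i\<in>I. A (-1) i)
      = expectation (\<lambda>\<omega>. of_real (tilt 1 \<omega>) * (\<Prod>i\<in>I. ph (U i \<omega>)) - of_real (tilt (-1) \<omega>) * (\<Prod>i\<in>I. ph (U i \<omega>)))"
      using tilted[of 1] tilted[of "-1"] by simp
    also have "norm \<dots> \<le> expectation (\<lambda>\<omega>. norm
      (of_real (tilt 1 \<omega>) * (\<Prod>i\<in>I. ph (U i \<omega>)) - of_real (tilt (-1) \<omega>) * (\<Prod>i\<in>I. ph (U i \<omega>))))"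
      by (rule integral_norm_bound)
    also have "\<dots> = tilt_distance"
      unfolding tilt_distance_def
    proof (intro Bochner_Integration.integral_cong refl)
      fix \<omega>
      have "norm (\<Prod>i\<in>I. ph (U i \<omega>)) = 1"
        by (simp add: prod_norm[symmetric] ph_def)
      then show "norm (of_real (tilt 1 \<omega>) * (\<Prod>i\<in>I. ph (U i \<omega>)) - of_real (tilt (-1) \<omega>) * (\<Prod>i\<in>I. ph (U i \<omega>)))
        = \<bar>tilt 1 \<omega> - tilt (-1) \<omega>\<bar>"
        unfolding left_diff_distrib[symmetric] of_real_diff[symmetric] norm_mult
        by (simp only: norm_of_real mult_1_right)
    qed
    finally show ?thesis .
  qed
  have tele: "norm ((\<Prod>i\<in>I. A 1 i) - (\<Prod>i\<in>I. A (-1) i) - (\<Sum>i\<in>I. A 1 i - A (-1) i))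
    \<le> 16 * l\<^sup>2 * D"
  proof -
    have "norm ((\<Prod>i\<in>I. A 1 i) - (\<Prod>i\<in>I. A (-1) i) - (\<Sum>i\<in>I. A 1 i - A (-1) i))
      \<le> (\<Sum>i\<in>I. 4 * l * excess T i) * (\<Sum>i\<in>I. norm (A 1 i - A (-1) i))"
      unfolding A_def using l assms
      by (intro norm_prod_diff_minus_sum_le centred_unit_rv.norm_tilted_phase
          centred_unit_rv.norm_tilted_phase_minus_1 crd finite_I) auto
    also have "\<dots> \<le> (4 * l * 2) * (2 * l * D)"
    proof (rule mult_mono)
      show "(\<Sum>i\<in>I. 4 * l * excess T i) \<le> 4 * l * 2"
        unfolding sum_distrib_left[symmetric] using l sum_excess_le by (intro mult_left_mono) auto
      show "(\<Sum>i\<in>I. norm (A 1 i - A (-1) i)) \<le> 2 * l * D"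
        unfolding D_def sum_distrib_left A_def
        by (intro sum_mono centred_unit_rv.tilted_phase_difference crd l)
      show "0 \<le> (\<Sum>i\<in>I. norm (A 1 i - A (-1) i))" by (intro sum_nonneg) auto
      show "0 \<le> 4 * l * 2" using l by simp
    qed
    finally show ?thesis by (simp add: power2_eq_square mult_ac)
  qed
  have lin: "norm ((\<Sum>i\<in>I. A 1 i - A (-1) i) - \<i> * of_real (2 * l * D)) \<le> l\<^sup>2 * D"
  proof -
    have "(\<Sum>i\<in>I. A 1 i - A (-1) i) - \<i> * of_real (2 * l * D)
      = (\<Sum>i\<in>I. A 1 i - A (-1) i - \<i> * of_real (2 * l * (energy T i / T)))"
      by (simp only: D_def sum_subtractf sum_distrib_left of_real_sum)
    also have "norm \<dots> \<le> (\<Sum>i\<in>I. l\<^sup>2 * (energy T i / T))"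
      unfolding A_def by (intro sum_norm_le centred_unit_rv.tilted_phase_difference crd l)
    finally show ?thesis by (simp add: D_def sum_distrib_left)
  qed
  have "norm z \<le> norm p + a + b" if "norm (p - q) \<le> a" "norm (q - z) \<le> b" for p q z :: complex and a b
    using norm_triangle_ineq4[of p "p - z"] norm_triangle_ineq[of "p - q" "q - z"] that by simp
  from this[OF tele lin]
  have "norm (\<i> * complex_of_real (2 * l * D))
    \<le> norm ((\<Prod>i\<in>I. A 1 i) - (\<Prod>i\<in>I. A (-1) i)) + 16 * l\<^sup>2 * D + l\<^sup>2 * D" .
  moreover have "norm (\<i> * complex_of_real (2 * l * D)) = 2 * l * D"
    using l D T_pos by (simp only: norm_mult norm_of_real norm_ii abs_of_nonneg) simp
  ultimately have "2 * l * D - 17 * l\<^sup>2 * D \<le> tilt_distance"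
    using upper by linarith
  then have "23 / 400 * D \<le> tilt_distance"
    by (simp add: l_def power2_eq_square)
  then show ?thesis using D T_pos by linarith
qed

text \<open>
  Pointwise \<open>\<bar>f - g\<bar> \<ge> f + g - 2 \<surd>(f g)\<close>, and the affinity \<open>E \<surd>(f g)\<close> factorises.
\<close>
lemma tilt_distance_lower_large:
  assumes "1 \<le> T"
  shows "2/3 \<le> tilt_distance"
proof -
  note crd = coordinate[OF _ T_pos]
  define m where "m i = expectation (\<lambda>\<omega>. (U i \<omega>)\<^sup>2)" for i
  have int2: "integrable M (\<lambda>\<omega>. (U i \<omega>)\<^sup>2)" if "i \<in> I" for i
    by (rule centred_unit_rv.integrable_bounded_image[OF crd[OF that], of "\<lambda>y. y\<^sup>2" 1])
       (auto simp: abs_square_le_1)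
  have ints: "integrable M (\<lambda>\<omega>. sqrt (1 - (U i \<omega>)\<^sup>2))" if "i \<in> I" for i
    by (rule centred_unit_rv.integrable_bounded_image[OF crd[OF that], of "\<lambda>y. sqrt (1 - y\<^sup>2)" 1])
       (auto simp: abs_square_le_1)
  have m: "excess T i \<le> m i / 2" if "i \<in> I" for i
  proof -
    have "0 \<le> m i" unfolding m_def by simp
    moreover have "1 \<le> T\<^sup>2" using assms by simp
    ultimately have "m i / T\<^sup>2 \<le> m i" using T_pos by (simp add: divide_le_eq mult_le_cancel_left1)
    then show ?thesis
      using centred_unit_rv.excess_le_second_moment[OF crd[OF that]] by (simp add: m_def)
  qed
  have sqrt_le: "sqrt (1 - x) \<le> 1 - x / 2" if "x \<le> 1" for x :: real
  proof (rule real_le_lsqrt)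
    show "1 - x \<le> (1 - x / 2)\<^sup>2" by (simp add: power2_diff)
  qed (use that in auto)
  have affinity: "expectation (\<lambda>\<omega>. \<Prod>i\<in>I. sqrt (1 - (U i \<omega>)\<^sup>2)) \<le> 2/3"
  proof -
    have "expectation (\<lambda>\<omega>. \<Prod>i\<in>I. sqrt (1 - (U i \<omega>)\<^sup>2)) = (\<Prod>i\<in>I. expectation (\<lambda>\<omega>. sqrt (1 - (U i \<omega>)\<^sup>2)))"
      using ints by (intro expectation_prod) auto
    also have "\<dots> \<le> (\<Prod>i\<in>I. exp (- (m i / 2)))"
    proof (intro prod_mono conjI)
      fix i assume i: "i \<in> I"
      have sq: "(U i \<omega>)\<^sup>2 \<le> 1" if "\<omega> \<in> space M" for \<omega>
        using abs_U_le_1[OF i that] by (simp add: abs_square_le_1)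
      show "0 \<le> expectation (\<lambda>\<omega>. sqrt (1 - (U i \<omega>)\<^sup>2))"
        using sq by (intro integral_nonneg_AE AE_I2) auto
      have "expectation (\<lambda>\<omega>. sqrt (1 - (U i \<omega>)\<^sup>2)) \<le> expectation (\<lambda>\<omega>. 1 - (U i \<omega>)\<^sup>2 / 2)"
        using ints[OF i] int2[OF i] sq by (intro integral_mono sqrt_le) auto
      also have "\<dots> = 1 + - (m i / 2)" using int2[OF i] by (simp add: m_def prob_space)
      also have "\<dots> \<le> exp (- (m i / 2))" by (rule exp_ge_add_one_self)
      finally show "expectation (\<lambda>\<omega>. sqrt (1 - (U i \<omega>)\<^sup>2)) \<le> exp (- (m i / 2))" .
    qed
    also have "\<dots> = exp (- (\<Sum>i\<in>I. m i / 2))"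
      by (simp add: exp_sum[symmetric] sum_negf)
    also have "\<dots> \<le> exp (- (1/2))"
      using sum_mono[of I "excess T" "\<lambda>i. m i / 2"] m sum_excess_ge by simp
    also have "\<dots> \<le> 2/3"
      using exp_ge_add_one_self[of "1/2 :: real"] by (simp add: exp_minus field_simps)
    finally show ?thesis .
  qed
  have "expectation (\<lambda>\<omega>. tilt 1 \<omega> + tilt (-1) \<omega> - 2 * (\<Prod>i\<in>I. sqrt (1 - (U i \<omega>)\<^sup>2))) \<le> tilt_distance"
    unfolding tilt_distance_def
  proof (rule integral_mono)
    show "integrable M (\<lambda>\<omega>. tilt 1 \<omega> + tilt (-1) \<omega> - 2 * (\<Prod>i\<in>I. sqrt (1 - (U i \<omega>)\<^sup>2)))"
      using integrable_tilt expectation_prod(2)[of "\<lambda>y. sqrt (1 - y\<^sup>2)"] ints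
      by (intro Bochner_Integration.integrable_diff Bochner_Integration.integrable_add integrable_mult_right) auto
    show "integrable M (\<lambda>\<omega>. \<bar>tilt 1 \<omega> - tilt (-1) \<omega>\<bar>)" using integrable_tilt by auto
  next
    fix \<omega> assume \<omega>: "\<omega> \<in> space M"
    define f g where "f = tilt 1 \<omega>" and "g = tilt (-1) \<omega>"
    have fg: "0 \<le> f" "0 \<le> g" unfolding f_def g_def using \<omega> by (auto intro: tilt_nonneg)
    have "(\<Prod>i\<in>I. sqrt (1 - (U i \<omega>)\<^sup>2)) = (\<Prod>i\<in>I. sqrt ((1 + 1 * U i \<omega>) * (1 + (-1) * U i \<omega>)))"
      by (intro prod.cong refl arg_cong[where f=sqrt]) (simp add: power2_eq_square algebra_simps)
    also have "\<dots> = sqrt f * sqrt g"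
      unfolding f_def g_def tilt_def real_sqrt_mult prod.distrib real_sqrt_prod ..
    also have "\<dots> \<ge> min f g"
    proof -
      have "min f g = sqrt (min f g) * sqrt (min f g)" using fg by simp
      also have "\<dots> \<le> sqrt f * sqrt g" using fg by (intro mult_mono) auto
      finally show ?thesis .
    qed
    finally show "tilt 1 \<omega> + tilt (-1) \<omega> - 2 * (\<Prod>i\<in>I. sqrt (1 - (U i \<omega>)\<^sup>2)) \<le> \<bar>tilt 1 \<omega> - tilt (-1) \<omega>\<bar>"
      unfolding f_def[symmetric] g_def[symmetric] by (simp add: min_def abs_if split: if_splits)
  qed
  moreover have "expectation (\<lambda>\<omega>. tilt 1 \<omega> + tilt (-1) \<omega> - 2 * (\<Prod>i\<in>I. sqrt (1 - (U i \<omega>)\<^sup>2)))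
    = 2 - 2 * expectation (\<lambda>\<omega>. \<Prod>i\<in>I. sqrt (1 - (U i \<omega>)\<^sup>2))"
    using integrable_tilt expectation_prod(2)[of "\<lambda>y. sqrt (1 - y\<^sup>2)"] ints
    by (simp add: expectation_tilt)
  ultimately show ?thesis using affinity by linarith
qed

lemma tilt_distance_lower: "min 1 T / 40 \<le> tilt_distance"
  using tilt_distance_lower_small tilt_distance_lower_large by (cases "T \<le> 1") auto

end

end

section \<open>The equation for the scale\<close>

lemma sqrt_one_plus_square_lipschitz: "\<bar>sqrt (1 + a\<^sup>2) - sqrt (1 + b\<^sup>2)\<bar> \<le> \<bar>a - b\<bar>" for a b :: real
  using norm_triangle_ineq3[of "Complex 1 a" "Complex 1 b"]
  by (simp add: cmod_def)

context centred_unit_family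
begin

text \<open>
  In terms of \<open>s = 1 / t\<close>, each mean \<open>E \<surd>(1 + (s U i)\<^sup>2)\<close> is Lipschitz in \<open>s\<close> and nondecreasing. A single
  coordinate that is not almost surely zero makes the sum of logarithms strictly increasing, and
  unbounded because \<open>\<surd>(1 + (s U)\<^sup>2) \<ge> s \<bar>U\<bar>\<close>; the intermediate value theorem applies.
\<close>
lemma ex1_log_weight_sum_eq_half:
  assumes "\<exists>i\<in>I. \<not> (AE \<omega> in M. U i \<omega> = 0)"
  shows "\<exists>!t. 0 < t \<and> log_weight_sum t = 1/2"
proof -
  define h where "h s i = expectation (\<lambda>\<omega>. sqrt (1 + (s * U i \<omega>)\<^sup>2))" for s i
  define H where "H s = (\<Sum>i\<in>I. ln (h s i))" for s
  have H: "log_weight_sum t = H (1 / t)" for t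
    unfolding log_weight_sum_def H_def h_def sqrt_weight_def by (simp add: power_divide)
  have int: "integrable M (\<lambda>\<omega>. sqrt (1 + (s * U i \<omega>)\<^sup>2))" if "i \<in> I" for s i
  proof (rule centred_unit_rv.integrable_bounded_image[OF coordinate[OF that zero_less_one], of "\<lambda>y. sqrt (1 + (s * y)\<^sup>2)" "sqrt (1 + s\<^sup>2)"])
    fix y :: real assume "\<bar>y\<bar> \<le> 1"
    then have "s\<^sup>2 * y\<^sup>2 \<le> s\<^sup>2 * 1" by (intro mult_left_mono) (auto simp: abs_square_le_1)
    then show "norm (sqrt (1 + (s * y)\<^sup>2)) \<le> sqrt (1 + s\<^sup>2)" by (simp add: power_mult_distrib)
  qed measurable
  have h_ge_1: "1 \<le> h s i" if "i \<in> I" for s i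
    unfolding h_def using int[OF that] by (intro integral_ge_const AE_I2) auto
  have pointwise_mono: "sqrt (1 + (r * y)\<^sup>2) \<le> sqrt (1 + (s * y)\<^sup>2)" if "0 \<le> r" "r \<le> s" for r s y :: real
    using that by (simp add: power_mult_distrib power_mono mult_right_mono)
  have h_mono: "h r i \<le> h s i" if "i \<in> I" "0 \<le> r" "r \<le> s" for r s i
    unfolding h_def using that by (intro integral_mono int pointwise_mono)
  obtain j where j: "j \<in> I" "\<not> (AE \<omega> in M. U j \<omega> = 0)" using assms by auto
  note measurable_U[OF j(1), measurable]
  have h_strict: "h r j < h s j" if "0 \<le> r" "r < s" for r s
    unfolding h_def
  proof (rule integral_less_AE[OF int int])
    define A where "A = {\<omega>\<in>space M. U j \<omega> \<noteq> 0}"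
    show A: "A \<in> sets M" unfolding A_def by measurable
    have "(AE \<omega> in M. U j \<omega> = 0) \<longleftrightarrow> emeasure M A = 0"
      by (rule AE_iff_measurable[OF A]) (simp add: A_def)
    then show "emeasure M A \<noteq> 0" using j(2) by simp
    show "AE \<omega> in M. \<omega> \<in> A \<longrightarrow> sqrt (1 + (r * U j \<omega>)\<^sup>2) \<noteq> sqrt (1 + (s * U j \<omega>)\<^sup>2)"
    proof (intro AE_I2 impI)
      fix \<omega> assume "\<omega> \<in> A"
      then have "0 < (U j \<omega>)\<^sup>2" by (simp add: A_def)
      moreover have "r\<^sup>2 < s\<^sup>2" using that by (intro power_strict_mono) auto
      ultimately have "(r * U j \<omega>)\<^sup>2 < (s * U j \<omega>)\<^sup>2"
        unfolding power_mult_distrib by (rule mult_strict_right_mono[rotated])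
      then have "sqrt (1 + (r * U j \<omega>)\<^sup>2) < sqrt (1 + (s * U j \<omega>)\<^sup>2)"
        by (intro real_sqrt_less_mono add_strict_left_mono)
      then show "sqrt (1 + (r * U j \<omega>)\<^sup>2) \<noteq> sqrt (1 + (s * U j \<omega>)\<^sup>2)"
        by (rule less_imp_neq)
    qed
    show "AE \<omega> in M. sqrt (1 + (r * U j \<omega>)\<^sup>2) \<le> sqrt (1 + (s * U j \<omega>)\<^sup>2)"
      using that by (intro AE_I2 pointwise_mono) auto
  qed (fact j(1))+
  have H_strict: "H r < H s" if "0 \<le> r" "r < s" for r s
    unfolding H_def
  proof (rule sum_strict_mono_ex1[OF finite_I])
    show "\<forall>i\<in>I. ln (h r i) \<le> ln (h s i)"
    proof
      fix i assume i: "i \<in> I"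
      have "0 < h r i" "h r i \<le> h s i"
        using h_ge_1[OF i, of r] h_mono[OF i that(1)] that(2) by auto
      then show "ln (h r i) \<le> ln (h s i)" by simp
    qed
    show "\<exists>i\<in>I. ln (h r i) < ln (h s i)"
    proof (rule bexI[OF _ j(1)])
      have "0 < h r j" "0 < h s j" using h_ge_1[OF j(1), of r] h_ge_1[OF j(1), of s] by auto
      then show "ln (h r j) < ln (h s j)" using h_strict[OF that] by (simp only: ln_less_cancel_iff)
    qed
  qed
  have cont: "continuous_on A H" for A
  proof -
    have "1-lipschitz_on UNIV (\<lambda>s. h s i)" if i: "i \<in> I" for i
    proof (rule lipschitz_onI)
      fix s r :: real
      have "\<bar>h s i - h r i\<bar> = \<bar>expectation (\<lambda>\<omega>. sqrt (1 + (s * U i \<omega>)\<^sup>2) - sqrt (1 + (r * U i \<omega>)\<^sup>2))\<bar>"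
        unfolding h_def using int[OF i] by simp
      also have "\<dots> \<le> expectation (\<lambda>\<omega>. \<bar>sqrt (1 + (s * U i \<omega>)\<^sup>2) - sqrt (1 + (r * U i \<omega>)\<^sup>2)\<bar>)"
        by (rule integral_abs_bound)
      also have "\<dots> \<le> \<bar>s - r\<bar>"
      proof (rule integral_le_const)
        show "integrable M (\<lambda>\<omega>. \<bar>sqrt (1 + (s * U i \<omega>)\<^sup>2) - sqrt (1 + (r * U i \<omega>)\<^sup>2)\<bar>)"
          using int[OF i] by auto
        show "AE \<omega> in M. \<bar>sqrt (1 + (s * U i \<omega>)\<^sup>2) - sqrt (1 + (r * U i \<omega>)\<^sup>2)\<bar> \<le> \<bar>s - r\<bar>"
        proof (rule AE_I2)
          fix \<omega> assume "\<omega> \<in> space M"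
          have "\<bar>s * U i \<omega> - r * U i \<omega>\<bar> = \<bar>s - r\<bar> * \<bar>U i \<omega>\<bar>"
            by (simp add: abs_mult left_diff_distrib[symmetric])
          also have "\<dots> \<le> \<bar>s - r\<bar> * 1"
            using abs_U_le_1[OF i \<open>\<omega> \<in> space M\<close>] by (intro mult_left_mono) auto
          finally show "\<bar>sqrt (1 + (s * U i \<omega>)\<^sup>2) - sqrt (1 + (r * U i \<omega>)\<^sup>2)\<bar> \<le> \<bar>s - r\<bar>"
            using sqrt_one_plus_square_lipschitz[of "s * U i \<omega>" "r * U i \<omega>"] by simp
        qed
      qed
      finally show "dist (h s i) (h r i) \<le> 1 * dist s r" by (simp add: dist_real_def)
    qed simp
    then have "continuous_on A (\<lambda>s. h s i)" if "i \<in> I" for i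
      using that lipschitz_on_continuous_on continuous_on_subset by blast
    moreover have "h s i \<noteq> 0" if "i \<in> I" for s i using h_ge_1[OF that, of s] by simp
    ultimately show ?thesis unfolding H_def by (intro continuous_intros) auto
  qed
  define e where "e = expectation (\<lambda>\<omega>. \<bar>U j \<omega>\<bar>)"
  have e: "e > 0"
  proof -
    have "e \<noteq> 0" using j(2) integral_nonneg_eq_0_iff_AE[of M "\<lambda>\<omega>. \<bar>U j \<omega>\<bar>"] integrable_U[OF j(1)]
      unfolding e_def by auto
    moreover have "0 \<le> e" unfolding e_def by simp
    ultimately show ?thesis by simp
  qed
  \<comment> \<open>at \<open>s = 2 / e\<close> the coordinate \<open>j\<close> alone contributes at least \<open>ln 2 \<ge> 1/2\<close>\<close>
  have top: "1/2 \<le> H (2 / e)"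
  proof -
    have "2 / e * e = expectation (\<lambda>\<omega>. 2 / e * \<bar>U j \<omega>\<bar>)" by (simp only: e_def integral_mult_right_zero)
    also have "\<dots> \<le> h (2 / e) j"
      unfolding h_def
    proof (intro integral_mono int j(1) integrable_mult_right integrable_abs integrable_U)
      fix \<omega>
      have "2 / e * \<bar>U j \<omega>\<bar> = sqrt ((2 / e * U j \<omega>)\<^sup>2)" using e by (simp add: abs_mult)
      also have "\<dots> \<le> sqrt (1 + (2 / e * U j \<omega>)\<^sup>2)" by (rule real_sqrt_le_mono) simp
      finally show "2 / e * \<bar>U j \<omega>\<bar> \<le> sqrt (1 + (2 / e * U j \<omega>)\<^sup>2)" .
    qed
    finally have "2 \<le> h (2 / e) j" using e by simp
    then have "ln 2 \<le> ln (h (2 / e) j)" by simp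
    also have "\<dots> \<le> H (2 / e)" unfolding H_def
      using h_ge_1 j(1) by (intro member_le_sum) (auto intro!: ln_ge_zero)
    finally have "ln 2 \<le> H (2 / e)" .
    moreover have "1/2 \<le> ln (2::real)"
      using exp_half_le2 by (subst ln_ge_iff) auto
    ultimately show ?thesis by linarith
  qed
  have H0: "H 0 = 0" by (simp add: H_def h_def prob_space)
  obtain s where s: "0 \<le> s" "H s = 1/2"
    using IVT'[of H 0 "1/2" "2 / e"] H0 top cont e by auto
  with H0 have "s \<noteq> 0" by auto
  show ?thesis
  proof (rule ex1I[of _ "1 / s"])
    show "0 < 1 / s \<and> log_weight_sum (1 / s) = 1/2" using s \<open>s \<noteq> 0\<close> by (simp add: H)
    fix t assume t: "0 < t \<and> log_weight_sum t = 1/2"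
    have "1 / t = s"
      using H_strict[of "1 / t" s] H_strict[of s "1 / t"] t s by (cases "1 / t" s rule: linorder_cases) (auto simp: H)
    then show "t = 1 / s" by auto
  qed
qed

end

section \<open>Product measures as tilts of a joint law\<close>

text \<open>
  By independence both sides agree on boxes: the density and the indicator of a box are
  products over the coordinates.
\<close>
lemma PiM_eq_distr_density:
  fixes P :: "'i \<Rightarrow> 'a measure"
  assumes M: "prob_space M" and fin: "finite I" and ind: "prob_space.indep_vars M P X I"
    and P: "\<And>i. i \<in> I \<Longrightarrow> prob_space (P i)"
    and r: "\<And>i. i \<in> I \<Longrightarrow> r i \<in> borel_measurable (P i)" "\<And>i x. i \<in> I \<Longrightarrow> 0 \<le> r i x"
    and dens: "\<And>i A. i \<in> I \<Longrightarrow> A \<in> sets (P i) \<Longrightarrow>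
      emeasure (P i) A = (\<integral>\<^sup>+\<omega>. ennreal (r i (X i \<omega>)) * indicator A (X i \<omega>) \<partial>M)"
  shows "PiM I P = distr (density M (\<lambda>\<omega>. ennreal (\<Prod>i\<in>I. r i (X i \<omega>)))) (PiM I P) (\<lambda>\<omega>. \<lambda>i\<in>I. X i \<omega>)"
proof -
  interpret prob_space M by fact
  have X: "X i \<in> M \<rightarrow>\<^sub>M P i" if "i \<in> I" for i
    using ind that unfolding indep_vars_def2 by auto
  have rX: "(\<lambda>\<omega>. r i (X i \<omega>)) \<in> borel_measurable M" if "i \<in> I" for i
    using measurable_compose[OF X r(1)] that by auto
  have vec: "(\<lambda>\<omega>. \<lambda>i\<in>I. X i \<omega>) \<in> M \<rightarrow>\<^sub>M PiM I P"
    using X by (intro measurable_restrict) auto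
  \<comment> \<open>the uniqueness theorem for product measures needs a probability measure at every index, also outside \<open>I\<close>\<close>
  define P' where "P' i = (if i \<in> I then P i else return (count_space UNIV) undefined)" for i
  have "prob_space (P' i)" for i
    unfolding P'_def using P by (auto intro!: prob_space_return)
  then interpret P': product_sigma_finite P'
    by (intro product_sigma_finite.intro) (rule prob_space_imp_sigma_finite)
  have PP': "PiM I P = PiM I P'" by (intro PiM_cong) (auto simp: P'_def)
  have "distr (density M (\<lambda>\<omega>. ennreal (\<Prod>i\<in>I. r i (X i \<omega>)))) (PiM I P) (\<lambda>\<omega>. \<lambda>i\<in>I. X i \<omega>) = PiM I P'"
  proof (rule P'.PiM_eqI[OF fin])
    fix A assume "\<And>i. i \<in> I \<Longrightarrow> A i \<in> sets (P' i)"
    then have A: "A i \<in> sets (P i)" if "i \<in> I" for i using that by (auto simp: P'_def)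
    have box: "Pi\<^sub>E I A \<in> sets (PiM I P)" using A fin by (intro sets_PiM_I_finite)
    have "emeasure (distr (density M (\<lambda>\<omega>. ennreal (\<Prod>i\<in>I. r i (X i \<omega>)))) (PiM I P) (\<lambda>\<omega>. \<lambda>i\<in>I. X i \<omega>)) (Pi\<^sub>E I A)
      = (\<integral>\<^sup>+\<omega>. ennreal (\<Prod>i\<in>I. r i (X i \<omega>)) * indicator ((\<lambda>\<omega>. \<lambda>i\<in>I. X i \<omega>) -` Pi\<^sub>E I A \<inter> space M) \<omega> \<partial>M)"
      using vec box rX by (subst emeasure_distr) (auto intro!: emeasure_density measurable_sets)
    also have "\<dots> = (\<integral>\<^sup>+\<omega>. (\<Prod>i\<in>I. ennreal (r i (X i \<omega>)) * indicator (A i) (X i \<omega>)) \<partial>M)"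
    proof (rule nn_integral_cong)
      fix \<omega> assume \<omega>: "\<omega> \<in> space M"
      show "ennreal (\<Prod>i\<in>I. r i (X i \<omega>)) * indicator ((\<lambda>\<omega>. \<lambda>i\<in>I. X i \<omega>) -` Pi\<^sub>E I A \<inter> space M) \<omega>
        = (\<Prod>i\<in>I. ennreal (r i (X i \<omega>)) * indicator (A i) (X i \<omega>))"
      proof (cases "\<forall>i\<in>I. X i \<omega> \<in> A i")
        case True
        then show ?thesis using \<omega> r(2) by (simp add: prod_ennreal)
      next
        case False
        then have "(\<Prod>i\<in>I. ennreal (r i (X i \<omega>)) * indicator (A i) (X i \<omega>)) = 0"
          using fin by (intro prod_zero) (auto simp: indicator_def)
        then show ?thesis using False by (auto simp: indicator_def PiE_iff)
      qed
    qed
    also have "\<dots> = (\<Prod>i\<in>I. \<integral>\<^sup>+\<omega>. ennreal (r i (X i \<omega>)) * indicator (A i) (X i \<omega>) \<partial>M)"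
      using r(1) A by (intro indep_vars_nn_integral fin
          indep_vars_compose2[OF ind, of "\<lambda>i x. ennreal (r i x) * indicator (A i) x"]) auto
    also have "\<dots> = (\<Prod>i\<in>I. emeasure (P' i) (A i))"
      using dens A by (intro prod.cong) (auto simp: P'_def)
    finally show "emeasure (distr (density M (\<lambda>\<omega>. ennreal (\<Prod>i\<in>I. r i (X i \<omega>)))) (PiM I P) (\<lambda>\<omega>. \<lambda>i\<in>I. X i \<omega>)) (Pi\<^sub>E I A)
      = (\<Prod>i\<in>I. emeasure (P' i) (A i))" .
  qed (simp add: PP')
  then show ?thesis using PP' by simp
qed

lemma measure_distr_density:
  fixes f :: "'a \<Rightarrow> real"
  assumes "X \<in> M \<rightarrow>\<^sub>M N" "f \<in> borel_measurable M" "\<And>\<omega>. \<omega> \<in> space M \<Longrightarrow> 0 \<le> f \<omega>" "B \<in> sets N"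
  shows "measure (distr (density M (\<lambda>\<omega>. ennreal (f \<omega>))) N X) B = (LINT \<omega>|M. f \<omega> * indicator B (X \<omega>))"
proof -
  have "measure (distr (density M (\<lambda>\<omega>. ennreal (f \<omega>))) N X) B
    = (LINT x|distr (density M (\<lambda>\<omega>. ennreal (f \<omega>))) N X. indicator B x)"
    using sets.sets_into_space[OF assms(4)] by (simp add: Int_absorb2)
  also have "\<dots> = (LINT \<omega>|density M (\<lambda>\<omega>. ennreal (f \<omega>)). indicator B (X \<omega>))"
    using assms by (intro integral_distr) auto
  also have "\<dots> = (LINT \<omega>|M. f \<omega> *\<^sub>R indicator B (X \<omega>))"
    using assms by (intro integral_density AE_I2 measurable_compose[OF assms(1)]) auto
  finally show ?thesis by simp
qed

text \<open>The supremum is attained at the set where \<open>G \<le> F\<close>.\<close>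
lemma total_variation_eq_half_L1_distance:
  fixes F G :: "'b \<Rightarrow> real"
  assumes X: "X \<in> M \<rightarrow>\<^sub>M P"
    and F: "F \<in> borel_measurable P" "integrable M (\<lambda>\<omega>. F (X \<omega>))"
    and G: "G \<in> borel_measurable P" "integrable M (\<lambda>\<omega>. G (X \<omega>))"
    and P: "prob_space P" "\<And>B. B \<in> sets P \<Longrightarrow> measure P B = (LINT \<omega>|M. F (X \<omega>) * indicator B (X \<omega>))"
    and Q: "prob_space Q" "sets Q = sets P"
      "\<And>B. B \<in> sets P \<Longrightarrow> measure Q B = (LINT \<omega>|M. G (X \<omega>) * indicator B (X \<omega>))"
  shows "total_variation P Q = (LINT \<omega>|M. \<bar>F (X \<omega>) - G (X \<omega>)\<bar>) / 2"
proof -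
  interpret P: prob_space P by fact
  interpret Q: prob_space Q by fact
  define L where "L = (LINT \<omega>|M. \<bar>F (X \<omega>) - G (X \<omega>)\<bar>)"
  have ind: "(\<lambda>\<omega>. indicator B (X \<omega>) :: real) \<in> borel_measurable M" if "B \<in> sets P" for B
    using that by (intro measurable_compose[OF X]) auto
  have int: "integrable M (\<lambda>\<omega>. k (X \<omega>) * indicator B (X \<omega>))"
    if "B \<in> sets P" "integrable M (\<lambda>\<omega>. k (X \<omega>))" for B and k :: "'b \<Rightarrow> real"
    using that ind by (intro Bochner_Integration.integrable_bound[OF that(2)])
      (auto simp: indicator_def intro!: borel_measurable_times)
  have spc: "space Q = space P" using Q(2) by (rule sets_eq_imp_space_eq)
  \<comment> \<open>\<open>F - G\<close> integrates to \<open>0\<close>, so a set and its complement carry opposite differences\<close>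
  have two: "2 * (measure P B - measure Q B)
      = (LINT \<omega>|M. (F (X \<omega>) - G (X \<omega>)) * (if X \<omega> \<in> B then 1 else -1))" if B: "B \<in> sets P" for B
  proof -
    have C: "space P - B \<in> sets P" using B by auto
    have "measure P (space P - B) = 1 - measure P B" "measure Q (space P - B) = 1 - measure Q B"
      using P.prob_compl[OF B] Q.prob_compl[of B] B Q(2) spc by auto
    then have "2 * (measure P B - measure Q B)
      = (measure P B - measure Q B) - (measure P (space P - B) - measure Q (space P - B))" by simp
    also have "\<dots> = (LINT \<omega>|M. (F (X \<omega>) * indicator B (X \<omega>) - G (X \<omega>) * indicator B (X \<omega>))
      - (F (X \<omega>) * indicator (space P - B) (X \<omega>) - G (X \<omega>) * indicator (space P - B) (X \<omega>)))"
      unfolding P(2)[OF B] P(2)[OF C] Q(3)[OF B] Q(3)[OF C]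
      using int[OF B F(2)] int[OF B G(2)] int[OF C F(2)] int[OF C G(2)]
      by simp
    also have "\<dots> = (LINT \<omega>|M. (F (X \<omega>) - G (X \<omega>)) * (if X \<omega> \<in> B then 1 else -1))"
      using measurable_space[OF X] by (intro Bochner_Integration.integral_cong refl) (auto simp: indicator_def)
    finally show ?thesis .
  qed
  have bound: "\<bar>measure P B - measure Q B\<bar> \<le> L / 2" if B: "B \<in> sets P" for B
  proof -
    have "\<bar>2 * (measure P B - measure Q B)\<bar> \<le> (LINT \<omega>|M. \<bar>(F (X \<omega>) - G (X \<omega>)) * (if X \<omega> \<in> B then 1 else -1)\<bar>)"
      unfolding two[OF B] by (rule integral_abs_bound)
    also have "\<dots> = L" unfolding L_def by (intro Bochner_Integration.integral_cong refl) auto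
    finally show ?thesis unfolding abs_mult by simp
  qed
  define A where "A = {x\<in>space P. G x \<le> F x}"
  have A: "A \<in> sets P" unfolding A_def using F(1) G(1) by measurable
  have max: "2 * (measure P A - measure Q A) = L"
    unfolding two[OF A] L_def using measurable_space[OF X]
    by (intro Bochner_Integration.integral_cong refl) (auto simp: A_def)
  have attained: "\<bar>measure P A - measure Q A\<bar> = L / 2"
  proof -
    have "0 \<le> L" unfolding L_def by simp
    moreover have "measure P A - measure Q A = L / 2"
      using max by simp
    ultimately show ?thesis by simp
  qed
  have "total_variation P Q = L / 2"
    unfolding total_variation_def
  proof (rule antisym)
    show "(SUP B\<in>sets P. \<bar>measure P B - measure Q B\<bar>) \<le> L / 2"
      using A by (intro cSUP_least bound) auto
    show "L / 2 \<le> (SUP B\<in>sets P. \<bar>measure P B - measure Q B\<bar>)"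
      unfolding attained[symmetric] using A
      by (intro cSUP_upper bdd_aboveI2[OF bound])
  qed
  then show ?thesis by (simp add: L_def)
qed

section \<open>The derivative of the difference with respect to the sum\<close>

text \<open>
  The derivative \<open>u\<close> is bounded by \<open>1\<close> almost everywhere only. Clipping provides a version that
  obeys the bound everywhere, so that \<open>1 + u\<close> and \<open>1 - u\<close> become nonnegative densities.
\<close>
definition clip :: "real \<Rightarrow> real" where "clip y = max (-1) (min 1 y)"

lemma clip_measurable [measurable]: "clip \<in> borel_measurable borel"
  unfolding clip_def[abs_def] by measurable

lemma abs_clip_le_1: "\<bar>clip y\<bar> \<le> 1"
  by (auto simp: clip_def)

lemma clip_eq: "\<bar>y\<bar> \<le> 1 \<Longrightarrow> clip y = y"
  by (auto simp: clip_def)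

lemma
  assumes "prob_space P" "prob_space Q" "sets Q = sets P" "is_RN_deriv_diff_sum P Q u"
  shows RN_deriv_measurable: "u \<in> borel_measurable P"
    and RN_deriv_abs_le_1: "AE x in measure_plus P Q. \<bar>u x\<bar> \<le> 1"
    and emeasure_eq_density_plus: "\<And>A. A \<in> sets P \<Longrightarrow>
      emeasure P A = (\<integral>\<^sup>+x. ennreal (1 + clip (u x)) * indicator A x \<partial>midpoint_measure P Q)"
    and emeasure_eq_density_minus: "\<And>A. A \<in> sets P \<Longrightarrow>
      emeasure Q A = (\<integral>\<^sup>+x. ennreal (1 - clip (u x)) * indicator A x \<partial>midpoint_measure P Q)"
proof -
  interpret P: prob_space P by fact
  interpret Q: prob_space Q by fact
  define S where "S = measure_plus P Q"
  have sets_S [measurable_cong]: "sets S = sets P" by (simp add: S_def)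
  have u: "integrable S u"
    and diff: "\<And>A. A \<in> sets P \<Longrightarrow> measure P A - measure Q A = (LINT x:A|S. u x)"
    using assms(4) unfolding is_RN_deriv_diff_sum_def S_def by auto
  from u have um: "u \<in> borel_measurable S" by auto
  then show "u \<in> borel_measurable P" using sets_S by simp
  have em: "emeasure S A = ennreal (measure P A + measure Q A)" if "A \<in> sets P" for A
    unfolding S_def using that assms(3)
    by (simp add: emeasure_measure_plus P.emeasure_eq_measure Q.emeasure_eq_measure)
  have S_fin: "finite_measure S"
    using em[OF sets.top] by (intro finite_measureI) (simp add: S_def)
  interpret S: finite_measure S by fact
  have ms: "measure S A = measure P A + measure Q A" if "A \<in> sets P" for A
    unfolding measure_def[of S] em[OF that] by (rule enn2real_ennreal) simp
  have int: "integrable S (\<lambda>x. (1 + s * u x) * indicator A x)" if "A \<in> sets P" for A s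
    using that u by (intro integrable_real_mult_indicator) (auto simp: sets_S)
  have val: "(LINT x|S. (1 + s * u x) * indicator A x)
    = measure P A + measure Q A + s * (measure P A - measure Q A)" if A: "A \<in> sets P" for A s
  proof -
    have "(LINT x|S. (1 + s * u x) * indicator A x) = (LINT x|S. indicator A x + s * (indicator A x * u x))"
      by (intro Bochner_Integration.integral_cong refl) (simp add: algebra_simps)
    also have "\<dots> = (LINT x|S. indicator A x) + s * (LINT x|S. indicator A x * u x)"
      using A u integrable_real_mult_indicator[of A S u]
      by (subst Bochner_Integration.integral_add) (auto simp: sets_S mult.commute intro!: integrable_real_indicator S.emeasure_finite[THEN less_top[THEN iffD1]] simp: less_top[symmetric])
    finally show ?thesis
      using diff[OF A] ms[OF A] sets.sets_into_space[OF A]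
      by (simp add: set_lebesgue_integral_def Int_absorb2 S_def)
  qed
  \<comment> \<open>on the set where \<open>1 + s u\<close> is negative its integral is \<open>2 P\<close> or \<open>2 Q\<close> of that set, hence nonnegative\<close>
  have half: "AE x in S. 0 \<le> 1 + s * u x" if s: "s = 1 \<or> s = -1" for s
  proof -
    define A where "A = {x\<in>space S. 1 + s * u x < 0}"
    have A: "A \<in> sets P" unfolding sets_S[symmetric] A_def using um by measurable
    have "0 \<le> (LINT x|S. (1 + s * u x) * indicator A x)" unfolding val[OF A] using s by auto
    moreover have "0 \<le> (LINT x|S. - ((1 + s * u x) * indicator A x))"
      by (intro integral_nonneg_AE AE_I2) (auto simp: A_def indicator_def)
    ultimately have "(LINT x|S. - ((1 + s * u x) * indicator A x)) = 0" by simp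
    then have "AE x in S. - ((1 + s * u x) * indicator A x) = 0"
      using int[OF A] by (subst (asm) integral_nonneg_eq_0_iff_AE) (auto simp: A_def indicator_def)
    then show ?thesis
      using AE_space by eventually_elim (auto simp: A_def indicator_def split: if_splits)
  qed
  have AE: "AE x in S. \<bar>u x\<bar> \<le> 1"
  proof -
    have "AE x in S. 0 \<le> 1 + 1 * u x" "AE x in S. 0 \<le> 1 + (-1) * u x" by (rule half, simp)+
    then show ?thesis by eventually_elim auto
  qed
  then show "AE x in measure_plus P Q. \<bar>u x\<bar> \<le> 1" unfolding S_def .
  have key: "(\<integral>\<^sup>+x. ennreal (1 + s * clip (u x)) * indicator A x \<partial>midpoint_measure P Q)
    = ennreal ((measure P A + measure Q A + s * (measure P A - measure Q A)) / 2)"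
    if A: "A \<in> sets P" and s: "s = 1 \<or> s = -1" for A s
  proof -
    have "(\<integral>\<^sup>+x. ennreal (1 + s * clip (u x)) * indicator A x \<partial>midpoint_measure P Q)
      = 1/2 * (\<integral>\<^sup>+x. ennreal (1 + s * clip (u x)) * indicator A x \<partial>S)"
      unfolding midpoint_measure_def S_def[symmetric] using um A sets_S
      by (intro nn_integral_scale_measure) auto
    also have "(\<integral>\<^sup>+x. ennreal (1 + s * clip (u x)) * indicator A x \<partial>S)
      = (\<integral>\<^sup>+x. ennreal ((1 + s * u x) * indicator A x) \<partial>S)"
      using AE by (intro nn_integral_cong_AE) (auto elim!: eventually_mono simp: clip_eq indicator_def)
    also have "\<dots> = ennreal (LINT x|S. (1 + s * u x) * indicator A x)"
      using half[OF s] by (intro nn_integral_eq_integral int A) (auto elim!: eventually_mono)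
    also have "1/2 * \<dots> = ennreal (1/2 * (LINT x|S. (1 + s * u x) * indicator A x))"
      by (subst ennreal_mult') (auto simp: ennreal_divide_numeral[of 1 "num.Bit0 num.One", simplified] divide_ennreal_def)
    finally show ?thesis using val[OF A] by simp
  qed
  fix A assume A: "A \<in> sets P"
  show "emeasure P A = (\<integral>\<^sup>+x. ennreal (1 + clip (u x)) * indicator A x \<partial>midpoint_measure P Q)"
    using key[OF A, of 1] by (simp add: P.emeasure_eq_measure)
  show "emeasure Q A = (\<integral>\<^sup>+x. ennreal (1 - clip (u x)) * indicator A x \<partial>midpoint_measure P Q)"
    using key[OF A, of "-1"] by (simp add: Q.emeasure_eq_measure)
qed

lemma AE_midpoint_measureI:
  assumes "AE x in measure_plus P Q. R x"
  shows "AE x in midpoint_measure P Q. R x"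
proof -
  from assms obtain N where N: "{x\<in>space (measure_plus P Q). \<not> R x} \<subseteq> N" "emeasure (measure_plus P Q) N = 0"
      "N \<in> sets (measure_plus P Q)"
    by (rule AE_E)
  then show ?thesis
    by (intro AE_I[of _ _ N]) (auto simp: midpoint_measure_def space_scale_measure)
qed

section \<open>The theorem\<close>

text \<open>
  The clipped derivatives evaluated along \<open>X\<close> form a centred family whose tilts are the
  densities of the two product measures, and the change on a null set does not affect the sum of
  logarithms. The bounds on \<open>tilt_distance\<close> then carry over with an additional factor \<open>1/2\<close>.
\<close>
lemma total_variation_bounds:
  fixes P Q :: "nat \<Rightarrow> 'a measure" and \<Omega> :: "'b measure"
  assumes PQ: "\<And>i. i \<in> {1..n} \<Longrightarrow> prob_space (P i) \<and> prob_space (Q i) \<and> sets (Q i) = sets (P i)"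
    and u: "\<And>i. i \<in> {1..n} \<Longrightarrow> is_RN_deriv_diff_sum (P i) (Q i) (u i)"
    and \<Omega>: "prob_space \<Omega>"
    and ind: "prob_space.indep_vars \<Omega> P X {1..n}"
    and X_distr: "\<And>i. i \<in> {1..n} \<Longrightarrow> distr \<Omega> (P i) (X i) = midpoint_measure (P i) (Q i)"
  defines "PP \<equiv> PiM {1..n} P" and "QQ \<equiv> PiM {1..n} Q"
    and "G \<equiv> log_sqrt_sum \<Omega> n (\<lambda>i \<omega>. u i (X i \<omega>))"
  shows "PP \<noteq> QQ \<Longrightarrow> \<exists>!t. 0 < t \<and> G t = 1/2"
    and "0 < t \<Longrightarrow> G t = 1/2 \<Longrightarrow> min 1 t / 80 \<le> total_variation PP QQ"
    and "0 < t \<Longrightarrow> G t = 1/2 \<Longrightarrow> total_variation PP QQ \<le> 10 * min 1 t"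
proof -
  interpret prob_space \<Omega> by fact
  define U where "U i \<omega> = clip (u i (X i \<omega>))" for i \<omega>
  let ?I = "{1..n}"
  have X: "X i \<in> \<Omega> \<rightarrow>\<^sub>M P i" if "i \<in> ?I" for i
    using ind that unfolding indep_vars_def2 by auto
  have um: "u i \<in> borel_measurable (P i)" if "i \<in> ?I" for i
    using RN_deriv_measurable PQ[OF that] u[OF that] by blast
  have cm: "(\<lambda>x. clip (u i x)) \<in> borel_measurable (P i)" if "i \<in> ?I" for i
    using measurable_compose[OF um[OF that] clip_measurable] .
  have sets_Q: "sets (Q i) = sets (P i)" if "i \<in> ?I" for i using PQ[OF that] by auto
  have dens: "emeasure (P i) A = (\<integral>\<^sup>+\<omega>. ennreal (1 + 1 * clip (u i (X i \<omega>))) * indicator A (X i \<omega>) \<partial>\<Omega>)"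
    "emeasure (Q i) A = (\<integral>\<^sup>+\<omega>. ennreal (1 + (-1) * clip (u i (X i \<omega>))) * indicator A (X i \<omega>) \<partial>\<Omega>)"
    if i: "i \<in> ?I" and A: "A \<in> sets (P i)" for i A
  proof -
    have tr: "(\<integral>\<^sup>+x. ennreal (1 + s * clip (u i x)) * indicator A x \<partial>midpoint_measure (P i) (Q i))
      = (\<integral>\<^sup>+\<omega>. ennreal (1 + s * clip (u i (X i \<omega>))) * indicator A (X i \<omega>) \<partial>\<Omega>)" for s
      unfolding X_distr[OF i, symmetric] using cm[OF i] A
      by (intro nn_integral_distr X i) auto
    show "emeasure (P i) A = (\<integral>\<^sup>+\<omega>. ennreal (1 + 1 * clip (u i (X i \<omega>))) * indicator A (X i \<omega>) \<partial>\<Omega>)"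
      unfolding tr[symmetric] using emeasure_eq_density_plus[of "P i" "Q i" "u i"] PQ[OF i] u[OF i] A by simp
    show "emeasure (Q i) A = (\<integral>\<^sup>+\<omega>. ennreal (1 + (-1) * clip (u i (X i \<omega>))) * indicator A (X i \<omega>) \<partial>\<Omega>)"
      unfolding tr[symmetric] using emeasure_eq_density_minus[of "P i" "Q i" "u i"] PQ[OF i] u[OF i] A by simp
  qed
  have Um: "U i \<in> borel_measurable \<Omega>" if "i \<in> ?I" for i
    unfolding U_def[abs_def] using measurable_compose[OF X[OF that] cm[OF that]] .
  have Uint: "integrable \<Omega> (U i)" if "i \<in> ?I" for i
    using Um[OF that] abs_clip_le_1 by (intro integrable_const_bound[of _ 1]) (auto simp: U_def)
  interpret F: centred_unit_family \<Omega> ?I U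
  proof
    show "indep_vars (\<lambda>_. borel) U ?I"
      unfolding U_def[abs_def] by (rule indep_vars_compose2[OF ind]) (rule cm)
    show "\<bar>U i \<omega>\<bar> \<le> 1" for i \<omega> unfolding U_def by (rule abs_clip_le_1)
    fix i assume i: "i \<in> ?I"
    interpret Pi: prob_space "P i" using PQ[OF i] by auto
    have U_ge: "0 \<le> 1 + U i \<omega>" for \<omega>
      using abs_clip_le_1[of "u i (X i \<omega>)"] by (auto simp: U_def)
    have "1 = (\<integral>\<^sup>+\<omega>. ennreal (1 + 1 * clip (u i (X i \<omega>))) * indicator (space (P i)) (X i \<omega>) \<partial>\<Omega>)"
      using dens(1)[OF i sets.top] Pi.emeasure_space_1 by simp
    also have "\<dots> = (\<integral>\<^sup>+\<omega>. ennreal (1 + U i \<omega>) \<partial>\<Omega>)"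
      using measurable_space[OF X[OF i]] by (intro nn_integral_cong) (simp add: U_def)
    also have "\<dots> = ennreal (expectation (\<lambda>\<omega>. 1 + U i \<omega>))"
      by (intro nn_integral_eq_integral AE_I2) (use Uint[OF i] U_ge in auto)
    finally have "expectation (\<lambda>\<omega>. 1 + U i \<omega>) = 1" by simp
    then show "expectation (U i) = 0" using Uint[OF i] by (simp add: prob_space)
  qed simp
  have G: "G = F.log_weight_sum"
  proof
    fix t
    have "expectation (\<lambda>\<omega>. sqrt (1 + (u i (X i \<omega>))\<^sup>2 / t\<^sup>2)) = expectation (\<lambda>\<omega>. sqrt_weight t (U i \<omega>))"
      if i: "i \<in> ?I" for i
    proof (rule integral_cong_AE)
      have "AE x in midpoint_measure (P i) (Q i). \<bar>u i x\<bar> \<le> 1"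
        using RN_deriv_abs_le_1[of "P i" "Q i" "u i"] PQ[OF i] u[OF i] by (intro AE_midpoint_measureI) auto
      then have "AE \<omega> in \<Omega>. \<bar>u i (X i \<omega>)\<bar> \<le> 1"
        unfolding X_distr[OF i, symmetric] using um[OF i] by (subst (asm) AE_distr_iff[OF X[OF i]]) auto
      then show "AE \<omega> in \<Omega>. sqrt (1 + (u i (X i \<omega>))\<^sup>2 / t\<^sup>2) = sqrt_weight t (U i \<omega>)"
        by eventually_elim (simp add: U_def clip_eq sqrt_weight_def)
      show "(\<lambda>\<omega>. sqrt (1 + (u i (X i \<omega>))\<^sup>2 / t\<^sup>2)) \<in> borel_measurable \<Omega>"
        using measurable_compose[OF X[OF i] um[OF i]] by measurable
      show "(\<lambda>\<omega>. sqrt_weight t (U i \<omega>)) \<in> borel_measurable \<Omega>"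
        using Um[OF i] by measurable
    qed
    then show "G t = F.log_weight_sum t"
      unfolding G_def log_sqrt_sum_def F.log_weight_sum_def by simp
  qed
  show "\<exists>!t. 0 < t \<and> G t = 1/2" if "PP \<noteq> QQ"
    unfolding G
  proof (rule F.ex1_log_weight_sum_eq_half, rule ccontr)
    assume "\<not> (\<exists>i\<in>?I. \<not> (AE \<omega> in \<Omega>. U i \<omega> = 0))"
    then have AE: "AE \<omega> in \<Omega>. U i \<omega> = 0" if "i \<in> ?I" for i using that by blast
    have "P i = Q i" if i: "i \<in> ?I" for i
    proof (rule measure_eqI)
      fix A assume A: "A \<in> sets (P i)"
      show "emeasure (P i) A = emeasure (Q i) A"
        unfolding dens[OF i A] using AE[OF i]
        by (intro nn_integral_cong_AE) (auto elim!: eventually_mono simp: U_def)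
    qed (simp add: sets_Q[OF i])
    then have "PP = QQ" unfolding PP_def QQ_def by (intro PiM_cong) auto
    with that show False by simp
  qed
  have TV: "total_variation PP QQ = F.tilt_distance / 2"
  proof -
    define V where "V \<omega> = (\<lambda>i\<in>?I. X i \<omega>)" for \<omega>
    define H where "H s x = (\<Prod>i\<in>?I. 1 + s * clip (u i (x i)))" for s and x :: "nat \<Rightarrow> 'a"
    have V: "V \<in> \<Omega> \<rightarrow>\<^sub>M PP"
      unfolding V_def[abs_def] PP_def using X by (intro measurable_restrict) auto
    have HV: "H s (V \<omega>) = F.tilt s \<omega>" for s \<omega>
      unfolding H_def V_def F.tilt_def U_def by (intro prod.cong) auto
    have Hm: "H s \<in> borel_measurable PP" for s
      unfolding H_def[abs_def] PP_def
    proof (intro borel_measurable_prod borel_measurable_add borel_measurable_times borel_measurable_const)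
      fix i assume "i \<in> ?I"
      then show "(\<lambda>x. clip (u i (x i))) \<in> borel_measurable (PiM ?I P)"
        using measurable_compose[OF measurable_component_singleton[of i ?I P] cm[of i]] by simp
    qed
    have sets_QQ: "sets QQ = sets PP"
      unfolding PP_def QQ_def by (intro sets_PiM_cong) (auto simp: sets_Q)
    have ps: "prob_space (PiM ?I R)" if R: "\<And>i. i \<in> ?I \<Longrightarrow> prob_space (R i)" for R :: "nat \<Rightarrow> 'a measure"
      by (rule prob_space_PiM) (rule R)
    have law: "R' = distr (density \<Omega> (\<lambda>\<omega>. ennreal (F.tilt s \<omega>))) PP V"
      if s: "s = 1 \<or> s = -1" and R: "R' = PiM ?I R" "\<And>i. i \<in> ?I \<Longrightarrow> prob_space (R i)"
        "\<And>i. i \<in> ?I \<Longrightarrow> sets (R i) = sets (P i)"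
        "\<And>i A. i \<in> ?I \<Longrightarrow> A \<in> sets (P i) \<Longrightarrow> emeasure (R i) A
          = (\<integral>\<^sup>+\<omega>. ennreal (1 + s * clip (u i (X i \<omega>))) * indicator A (X i \<omega>) \<partial>\<Omega>)"
      for s R and R' :: "(nat \<Rightarrow> 'a) measure"
    proof -
      have sR: "sets (PiM ?I R) = sets PP" unfolding PP_def by (intro sets_PiM_cong) (auto simp: R(3))
      have indR: "indep_vars R X ?I"
        unfolding indep_vars_def2
      proof
        show "\<forall>i\<in>?I. random_variable (R i) (X i)"
          using X measurable_cong_sets[OF refl R(3)] by blast
        have "indep_sets (\<lambda>i. {X i -` A \<inter> space \<Omega> | A. A \<in> sets (P i)}) ?I"
          using ind unfolding indep_vars_def2 by blast
        then show "indep_sets (\<lambda>i. {X i -` A \<inter> space \<Omega> | A. A \<in> sets (R i)}) ?I"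
          by (rule indep_sets_cong[OF refl, THEN iffD1, rotated]) (simp add: R(3))
      qed
      have "PiM ?I R = distr (density \<Omega> (\<lambda>\<omega>. ennreal (\<Prod>i\<in>?I. 1 + s * clip (u i (X i \<omega>))))) (PiM ?I R) (\<lambda>\<omega>. \<lambda>i\<in>?I. X i \<omega>)"
      proof (rule PiM_eq_distr_density[OF \<Omega> _ indR])
        fix i assume i: "i \<in> ?I"
        show "(\<lambda>x. 1 + s * clip (u i x)) \<in> borel_measurable (R i)"
          using cm[OF i] R(3)[OF i] by (simp cong: measurable_cong_sets)
        show "0 \<le> 1 + s * clip (u i x)" for x
          using s abs_clip_le_1[of "u i x"] by auto
      qed (use R in auto)
      also have "\<dots> = distr (density \<Omega> (\<lambda>\<omega>. ennreal (F.tilt s \<omega>))) PP V"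
        unfolding V_def[abs_def] F.tilt_def U_def by (intro distr_cong sR refl)
      finally show ?thesis unfolding R(1) .
    qed
    have tilt_meas: "F.tilt s \<in> borel_measurable \<Omega>" for s using F.integrable_tilt by auto
    have meas: "measure R' B = (LINT \<omega>|\<Omega>. H s (V \<omega>) * indicator B (V \<omega>))"
      if "R' = distr (density \<Omega> (\<lambda>\<omega>. ennreal (F.tilt s \<omega>))) PP V" "B \<in> sets PP" "\<bar>s\<bar> = 1" for R' s B
      unfolding that(1) HV using that(2,3)
      by (intro measure_distr_density V tilt_meas F.tilt_nonneg) auto
    have lawP: "PP = distr (density \<Omega> (\<lambda>\<omega>. ennreal (F.tilt 1 \<omega>))) PP V"
      using dens(1) PQ by (intro law[of 1 PP P]) (auto simp: PP_def)
    have lawQ: "QQ = distr (density \<Omega> (\<lambda>\<omega>. ennreal (F.tilt (-1) \<omega>))) PP V"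
      using dens(2) PQ by (intro law[of "-1" QQ Q]) (auto simp: QQ_def)
    have "total_variation PP QQ = (LINT \<omega>|\<Omega>. \<bar>H 1 (V \<omega>) - H (-1) (V \<omega>)\<bar>) / 2"
    proof (rule total_variation_eq_half_L1_distance[OF V])
      show "prob_space PP" unfolding PP_def by (rule ps) (use PQ in blast)
      show "prob_space QQ" unfolding QQ_def by (rule ps) (use PQ in blast)
      show "measure PP B = (LINT \<omega>|\<Omega>. H 1 (V \<omega>) * indicator B (V \<omega>))" if "B \<in> sets PP" for B
        using meas[OF lawP that] by simp
      show "measure QQ B = (LINT \<omega>|\<Omega>. H (-1) (V \<omega>) * indicator B (V \<omega>))" if "B \<in> sets PP" for B
        using meas[OF lawQ that] by simp
    qed (simp_all only: Hm HV sets_QQ F.integrable_tilt)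
    then show ?thesis unfolding HV F.tilt_distance_def .
  qed
  show "min 1 t / 80 \<le> total_variation PP QQ" if "0 < t" "G t = 1/2"
    using F.tilt_distance_lower[of t] that by (simp add: TV G)
  show "total_variation PP QQ \<le> 10 * min 1 t" if "0 < t" "G t = 1/2"
    using F.tilt_distance_upper[of t] that by (simp add: TV G)
qed

theorem theorem1p2:
  "\<exists>c\<in>universal_range. \<exists>C\<in>universal_range. 0 < c \<and> c \<le> C \<and>
    (\<forall>(n::nat) (P :: nat \<Rightarrow> 'a measure) (Q :: nat \<Rightarrow> 'a measure) (u :: nat \<Rightarrow> 'a \<Rightarrow> real)
      (\<Omega> :: 'b measure) (X :: nat \<Rightarrow> 'b \<Rightarrow> 'a).
      1 \<le> n \<longrightarrow>
      (\<forall>i\<in>{1..n}. prob_space (P i) \<and> prob_space (Q i) \<and> sets (Q i) = sets (P i)) \<longrightarrow>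
      (\<forall>i\<in>{1..n}. is_RN_deriv_diff_sum (P i) (Q i) (u i)) \<longrightarrow>
      prob_space \<Omega> \<longrightarrow>
      prob_space.indep_vars \<Omega> P X {1..n} \<longrightarrow>
      (\<forall>i\<in>{1..n}. distr \<Omega> (P i) (X i) = midpoint_measure (P i) (Q i)) \<longrightarrow>
      (let PP = PiM {1..n} P;
           QQ = PiM {1..n} Q;
           G = log_sqrt_sum \<Omega> n (\<lambda>i \<omega>. u i (X i \<omega>));
           T = (if PP = QQ then 0 else (THE t. 0 < t \<and> G t = 1/2))
       in (PP \<noteq> QQ \<longrightarrow> (\<exists>!t. 0 < t \<and> G t = 1/2)) \<and>
          c * min 1 T \<le> total_variation PP QQ \<and>
          total_variation PP QQ \<le> C * min 1 T))"
proof (rule bexI[of _ "1/80"], rule bexI[of _ 10], intro conjI allI impI)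
  fix n :: nat and P Q :: "nat \<Rightarrow> 'a measure" and u :: "nat \<Rightarrow> 'a \<Rightarrow> real"
    and \<Omega> :: "'b measure" and X :: "nat \<Rightarrow> 'b \<Rightarrow> 'a"
  assume PQ: "\<forall>i\<in>{1..n}. prob_space (P i) \<and> prob_space (Q i) \<and> sets (Q i) = sets (P i)"
    and rest: "\<forall>i\<in>{1..n}. is_RN_deriv_diff_sum (P i) (Q i) (u i)" "prob_space \<Omega>"
    "prob_space.indep_vars \<Omega> P X {1..n}"
    "\<forall>i\<in>{1..n}. distr \<Omega> (P i) (X i) = midpoint_measure (P i) (Q i)"
  define PP QQ G where "PP = PiM {1..n} P" and "QQ = PiM {1..n} Q"
    and "G = log_sqrt_sum \<Omega> n (\<lambda>i \<omega>. u i (X i \<omega>))"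
  define T where "T = (if PP = QQ then 0 else (THE t. 0 < t \<and> G t = 1/2))"
  note bounds = total_variation_bounds[of n P Q u \<Omega> X, folded PP_def QQ_def G_def]
  have ex1: "\<exists>!t. 0 < t \<and> G t = 1/2" if "PP \<noteq> QQ"
    using PQ rest that by (intro bounds(1)) auto
  have "1/80 * min 1 T \<le> total_variation PP QQ \<and> total_variation PP QQ \<le> 10 * min 1 T"
  proof (cases "PP = QQ")
    case True
    have "sets PP \<noteq> {}" using sets.top by auto
    then have "total_variation PP PP = 0" by (simp add: total_variation_def)
    then show ?thesis using True by (simp add: T_def)
  next
    case False
    have "0 < T \<and> G T = 1/2" using theI'[OF ex1[OF False]] False by (simp add: T_def)
    then show ?thesis using bounds(2,3)[of T] PQ rest by auto
  qed
  then show "let PP = PiM {1..n} P; QQ = PiM {1..n} Q;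
           G = log_sqrt_sum \<Omega> n (\<lambda>i \<omega>. u i (X i \<omega>));
           T = (if PP = QQ then 0 else (THE t. 0 < t \<and> G t = 1/2))
       in (PP \<noteq> QQ \<longrightarrow> (\<exists>!t. 0 < t \<and> G t = 1/2)) \<and>
          1/80 * min 1 T \<le> total_variation PP QQ \<and>
          total_variation PP QQ \<le> 10 * min 1 T"
    using ex1 unfolding Let_def PP_def[symmetric] QQ_def[symmetric] G_def[symmetric] T_def[symmetric]
    by blast
qed (auto simp: universal_range_def)

end
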